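(* Suppose that $p(x)$ is Lipschitz continuous. Let $\Omega\subset\mathbb{R}^N$ be connected and let $0\le u\in C^1(\Omega)$ be such that $\Delta_{p(x)}u\le0$ in $\Omega$. If, moreover, there exists $y\in\partial\Omega$ such that there is a ball $B$ contained in $\Omega$ with $y\in\partial B$, $u\in C(\overline B)$, $u>0$ in $B$ and $u(y)=0$, then for $x\in B$ close enough to $y$ there holds that $$u(x)\ge c_0\,(x-y)\cdot\nu,$$ where $c_0>0$ and $\nu$ is the unit direction from $y$ to the center of the ball $B$. If moreover $u\in C^1(\Omega\cup\{y\})$, there holds that either $u\equiv0$ in $\Omega$ or else $\frac{\partial u(y)}{\partial\nu}>0$, with $\nu$ the unit direction from $y$ to the center of $B$.
   Context: $\Omega$ is an open set and the exponent $p:\Omega\to\mathbb{R}$ satisfies $1<p_1\le p(x)\le p_2<\infty$ in $\Omega$. $\Delta_{p(x)}u=\mathrm{div}(|\nabla u|^{p(x)-2}\nabla u)$, and $\Delta_{p(x)}u\le0$ is understood in the weak sense: $\int_\Omega|\nabla u|^{p(x)-2}\nabla u\cdot\nabla\phi\,dx\ge0$ for every nonnegative test function $\phi$ (e.g. $\phi\in C_0^\infty(\Omega)$).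
   Formalization: The growth estimate is claimed not on all of B near y (false for N≥2: u=1-|x|², p=2, Ω=B the unit ball) but for x near y in each ball of radius θR, 0<θ<1 (R the radius of B), internally tangent to B at y, with c_0 depending on θ. *)

theory Defs
  imports "HOL-Analysis.Analysis"
begin

definition grad :: "('a::euclidean_space \<Rightarrow> real) \<Rightarrow> 'a \<Rightarrow> 'a" where
  "grad u x = (THE D. GDERIV u x :> D)"

lemma grad_eq: "grad u x = D" if D: "GDERIV u x :> D"
  unfolding grad_def
proof (rule the_equality, rule D)
  fix D' assume "GDERIV u x :> D'"
  then have "(\<lambda>h. inner h D') = (\<lambda>h. inner h D)"
    using D unfolding gderiv_def by (rule has_derivative_unique)
  then have "\<And>h. inner h D' = inner h D"
    by metis
  then show "D' = D"
    by (metis vector_eq_ldot)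
qed

definition C1_on :: "'a::euclidean_space set \<Rightarrow> ('a \<Rightarrow> real) \<Rightarrow> bool" where
  "C1_on \<Omega> u \<longleftrightarrow> (\<forall>x\<in>\<Omega>. \<exists>D. GDERIV u x :> D) \<and> continuous_on \<Omega> (grad u)"

(* u is of class C^1 on \<Omega> \<union> {y} for a boundary point y of \<Omega>: both u and its gradient
   extend continuously from \<Omega> to y (u taking its own value u y there).  The value of grad u
   at y itself is not used, as u need not be differentiable (nor given) around y. *)
definition C1_upto :: "'a::euclidean_space set \<Rightarrow> 'a \<Rightarrow> ('a \<Rightarrow> real) \<Rightarrow> bool" where
  "C1_upto \<Omega> y u \<longleftrightarrow> C1_on \<Omega> u \<and> continuous_on (insert y \<Omega>) u \<and>
     (\<exists>G. continuous_on (insert y \<Omega>) G \<and> (\<forall>x\<in>\<Omega>. G x = grad u x))"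

primrec Ck :: "nat \<Rightarrow> ('a::euclidean_space \<Rightarrow> real) \<Rightarrow> bool" where
  "Ck 0 \<phi> \<longleftrightarrow> continuous_on UNIV \<phi>"
| "Ck (Suc k) \<phi> \<longleftrightarrow> (\<forall>x. \<exists>D. GDERIV \<phi> x :> D) \<and> (\<forall>b\<in>Basis. Ck k (\<lambda>x. grad \<phi> x \<bullet> b))"

(* C_0^\<infinity>(\<Omega>); its elements are regarded as functions on the whole space, extended by 0. *)
definition test_function :: "'a::euclidean_space set \<Rightarrow> ('a \<Rightarrow> real) \<Rightarrow> bool" where
  "test_function \<Omega> \<phi> \<longleftrightarrow> (\<forall>k. Ck k \<phi>) \<and>
     compact (closure {x. \<phi> x \<noteq> 0}) \<and> closure {x. \<phi> x \<noteq> 0} \<subseteq> \<Omega>"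

(* The vector field |v|^(q-2) v; it is 0 at v = 0 for every q, also for q < 2. *)
definition plap_field :: "real \<Rightarrow> 'a::euclidean_space \<Rightarrow> 'a" where
  "plap_field q v = (norm v powr (q - 2)) *\<^sub>R v"

(* div (|grad u|^(p(x)-2) grad u) \<le> 0 in \<Omega>, weakly.  To be used for u of class C^1 in \<Omega>
   and p continuous on \<Omega>; the integrand is then continuous with compact support in \<Omega>. *)
definition px_laplacian_nonpos ::
    "'a::euclidean_space set \<Rightarrow> ('a \<Rightarrow> real) \<Rightarrow> ('a \<Rightarrow> real) \<Rightarrow> bool" where
  "px_laplacian_nonpos \<Omega> p u \<longleftrightarrow>
     (\<forall>\<phi>. test_function \<Omega> \<phi> \<longrightarrow> (\<forall>x. \<phi> x \<ge> 0) \<longrightarrow>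
        (LINT x:\<Omega>|lborel. plap_field (p x) (grad u x) \<bullet> grad \<phi> x) \<ge> 0)"

end

theory Submission imports Defs begin

text \<open>
  The statement is a Hopf lemma, and the proof compares \<open>u\<close> with an explicit radial subsolution in
  a thin annulus \<open>A = {x. R - d < norm (x - z) < R}\<close> at the boundary of the ball.

  The barrier \<open>w\<close> is a multiple of \<open>exp (- \<mu> * norm (x - z))\<close> minus a constant, normalised so that \<open>w = 0\<close> on
  the outer sphere and \<open>w \<le> min u\<close> on the inner one.  Its flux for the p(x)-Laplacian is radial,
  \<open>- H x *\<^sub>R (x - z)\<close>, where \<open>H\<close> involves a power with exponent \<open>p x - 1\<close> and is therefore no smoother
  than \<open>p\<close>.  Instead of differentiating \<open>p\<close>, the integral of a radial derivative is written as a
  derivative with respect to dilations about \<open>z\<close> (\<open>radial_field_dilation\<close>); \<open>w\<close> is then a weak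
  subsolution if \<open>s powr N * H\<close>, with \<open>s = norm (x - z)\<close> and \<open>N\<close> the dimension, decreases along rays from
  \<open>z\<close>.  The exponential decay of the slope of \<open>w\<close> contributes \<open>- (p1 - 1) * \<mu>\<close> to its logarithmic
  derivative, the dimension \<open>(N - 1) / s\<close>, and the variation of \<open>p\<close> at most
  \<open>L * (\<bar>ln m\<bar> + \<mu> * d)\<close>, with \<open>L\<close> the Lipschitz constant of \<open>p\<close> and \<open>m\<close> the minimum of \<open>u\<close> on the inner
  sphere.  So it suffices to take \<open>d\<close> small compared with \<open>(p1 - 1) / L\<close> and, with \<open>d\<close> and \<open>m\<close> fixed,
  \<open>\<mu>\<close> large (\<open>barrier_flux_dilation\<close>).

  The comparison \<open>w \<le> u\<close> in \<open>A\<close> (\<open>plap_comparison\<close>) follows from the strict monotonicity of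
  \<open>plap_field\<close> by testing both inequalities with \<open>(max (w - u - \<delta>) 0)\<^sup>2\<close>.  This function is only
  C1, so the weak inequality for \<open>u\<close> is first extended to such test functions by
  mollification (\<open>weak_ineq_C1_test\<close>).

  The result, \<open>u x \<ge> c * (R - norm (x - z))\<close> in \<open>A\<close> (\<open>hopf_lower_bound\<close>), gives the growth estimate because
  in an internally tangent smaller ball \<open>R - norm (x - z)\<close> is comparable with \<open>(x - y) \<bullet> \<nu>\<close>.  If the
  gradient of \<open>u\<close> extends continuously to \<open>y\<close>, the mean value theorem along the normal gives the
  one-sided derivative, and the growth estimate bounds it below by \<open>c > 0\<close>.
\<close>

section \<open>Differentiability and integration\<close>

lemma C1_onD: "C1_on S u \<Longrightarrow> x \<in> S \<Longrightarrow> GDERIV u x :> grad u x"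
  unfolding C1_on_def using grad_eq by metis

lemma C1_on_cont_grad: "C1_on S u \<Longrightarrow> continuous_on S (grad u)"
  unfolding C1_on_def by blast

lemma GDERIV_isCont: "GDERIV f x :> D \<Longrightarrow> isCont f x"
  unfolding gderiv_def by (rule has_derivative_continuous)

lemma C1_on_cont: "C1_on S u \<Longrightarrow> continuous_on S u"
  by (meson C1_onD GDERIV_isCont continuous_at_imp_continuous_on)

lemma integrable_continuous_compact_support:
  fixes f :: "'a::euclidean_space \<Rightarrow> 'b::euclidean_space"
  assumes "continuous_on UNIV f" "compact K" "\<And>x. x \<notin> K \<Longrightarrow> f x = 0"
  shows "integrable lborel f"
proof -
  have "integrable lborel (\<lambda>x. indicator K x *\<^sub>R f x)"
    by (rule borel_integrable_compact[OF assms(2)]) (use assms(1) continuous_on_subset in blast)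
  also have "(\<lambda>x. indicator K x *\<^sub>R f x) = f"
    using assms(3) by (auto simp: indicator_def)
  finally show ?thesis .
qed

lemma lborel_integral_affine:
  fixes f :: "'a::euclidean_space \<Rightarrow> 'b::{banach, second_countable_topology}"
  assumes "f \<in> borel_measurable borel" "c \<noteq> 0"
  shows "(LINT x|lborel. f x) = \<bar>c\<bar> ^ DIM('a) *\<^sub>R (LINT x|lborel. f (t + c *\<^sub>R x))"
proof -
  have m: "(\<lambda>x. t + c *\<^sub>R x) \<in> borel_measurable borel" by simp
  have "(LINT x|lborel. f x)
      = (LINT x|density (distr lborel borel (\<lambda>x. t + c *\<^sub>R x)) (\<lambda>_. \<bar>c\<bar>^DIM('a)). f x)"
    using lborel_affine[OF assms(2), of t] by simp
  also have "\<dots> = \<bar>c\<bar> ^ DIM('a) *\<^sub>R (LINT x|distr lborel borel (\<lambda>x. t + c *\<^sub>R x). f x)"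
    using assms by (subst integral_density) auto
  also have "(LINT x|distr lborel borel (\<lambda>x. t + c *\<^sub>R x). f x) = (LINT x|lborel. f (t + c *\<^sub>R x))"
    using assms m by (subst integral_distr) auto
  finally show ?thesis .
qed

text \<open>The convolution of a scalar function with a scalar or vector-valued one, as a Lebesgue integral
over the whole space.\<close>

definition conv :: "('a::euclidean_space \<Rightarrow> real) \<Rightarrow> ('a \<Rightarrow> 'b::euclidean_space) \<Rightarrow> 'a \<Rightarrow> 'b" where
  "conv f g x = (LINT t|lborel. f t *\<^sub>R g (x - t))"

lemma continuous_conv_integrand:
  fixes g :: "'a::euclidean_space \<Rightarrow> 'b::euclidean_space"
  assumes "continuous_on UNIV f" "continuous_on UNIV g"
  shows "continuous_on UNIV (\<lambda>t. f t *\<^sub>R g (x - t))"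
  by (intro continuous_intros assms continuous_on_compose2[OF assms(2)]) auto

lemma integrable_conv_integrand:
  fixes g :: "'a::euclidean_space \<Rightarrow> 'b::euclidean_space"
  assumes "continuous_on UNIV f" "continuous_on UNIV g" "compact K" "\<And>x. x \<notin> K \<Longrightarrow> f x = 0"
  shows "integrable lborel (\<lambda>t. f t *\<^sub>R g (x - t))"
  by (rule integrable_continuous_compact_support[OF continuous_conv_integrand[OF assms(1,2)] assms(3)])
    (simp add: assms(4))

lemma conv_commute:
  assumes "continuous_on UNIV f" "continuous_on UNIV g"
  shows "conv f g x = conv g f x"
proof -
  have "(\<lambda>t. f t *\<^sub>R g (x - t)) \<in> borel_measurable borel"
    by (rule borel_measurable_continuous_onI[OF continuous_conv_integrand[OF assms]])
  from lborel_integral_affine[OF this, of "-1" x]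
  show ?thesis by (simp add: conv_def mult.commute)
qed

lemma conv_eq_integral_cbox:
  fixes g :: "'a::euclidean_space \<Rightarrow> 'b::euclidean_space"
  assumes "continuous_on UNIV f" "continuous_on UNIV g" "\<And>t. t \<notin> cbox a b \<Longrightarrow> f t = 0"
  shows "conv f g x = integral (cbox a b) (\<lambda>t. f t *\<^sub>R g (x - t))"
proof -
  have "((\<lambda>t. f t *\<^sub>R g (x - t)) has_integral conv f g x) UNIV"
    unfolding conv_def
    by (intro has_integral_integral_lborel integrable_conv_integrand[OF assms(1,2) compact_cbox])
      (rule assms(3))
  moreover have "\<And>t. t \<notin> cbox a b \<Longrightarrow> f t *\<^sub>R g (x - t) = 0" by (simp add: assms(3))
  ultimately have "((\<lambda>t. f t *\<^sub>R g (x - t)) has_integral conv f g x) (cbox a b)"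
    using has_integral_on_superset[of "\<lambda>t. f t *\<^sub>R g (x - t)"] 
    by (smt (verit, ccfv_SIG) has_integral_restrict_UNIV has_integral_eq)
  then show ?thesis by (simp add: integral_unique)
qed

text \<open>Only the second factor has to be differentiable.  Together with \<open>conv_commute\<close> this is used twice for
the same convolution: with a smooth kernel as second factor it gives smoothness, and with the
mollified C1 function as second factor it gives convergence of the gradients.\<close>

lemma GDERIV_conv:
  assumes f: "continuous_on UNIV f" and K: "compact K" "\<And>t. t \<notin> K \<Longrightarrow> f t = 0"
    and g: "C1_on UNIV g"
  shows "GDERIV (conv f g) x :> conv f (grad g) x"
proof -
  obtain a b where "K \<subseteq> cbox a b"
    using K(1) compact_imp_bounded bounded_subset_cbox_symmetric by metis
  then have supp: "\<And>t. t \<notin> cbox a b \<Longrightarrow> f t = 0" using K(2) by blast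
  have cg: "continuous_on UNIV g" "continuous_on UNIV (grad g)"
    using g C1_on_cont C1_on_cont_grad by auto
  define F where "F x t = f t *\<^sub>R blinfun_inner_left (grad g (x - t))" for x t
  have F: "blinfun_apply (F x t) h = h \<bullet> (f t *\<^sub>R grad g (x - t))" for x t h
    by (simp add: F_def blinfun.bilinear_simps)
  have cF: "continuous_on (UNIV \<times> cbox a b) (\<lambda>(x, t). F x t)"
    unfolding F_def split_def
    by (intro continuous_intros continuous_on_compose2[OF f] continuous_on_compose2[OF cg(2)]) auto
  have cF1: "continuous_on (cbox a b) (F x)"
    unfolding F_def
    by (intro continuous_intros continuous_on_compose2[OF f] continuous_on_compose2[OF cg(2)]) auto
  have "((\<lambda>x. integral (cbox a b) (\<lambda>t. f t *\<^sub>R g (x - t))) has_derivative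
      integral (cbox a b) (F x)) (at x within UNIV)"
  proof (rule leibniz_rule[OF _ _ cF])
    fix x t
    have "GDERIV g (x - t) :> grad g (x - t)" using g C1_onD by blast
    then have "((\<lambda>y. g (y - t)) has_derivative (\<lambda>h. h \<bullet> grad g (x - t))) (at x)"
      unfolding gderiv_def
      by (rule has_derivative_compose[rotated, where f = "\<lambda>y. y - t", simplified])
        (auto intro!: derivative_eq_intros)
    then have "((\<lambda>x. f t *\<^sub>R g (x - t)) has_derivative (\<lambda>h. f t *\<^sub>R (h \<bullet> grad g (x - t)))) (at x)"
      by (rule has_derivative_scaleR_right)
    moreover have "(\<lambda>h. f t *\<^sub>R (h \<bullet> grad g (x - t))) = blinfun_apply (F x t)"
      by (auto simp: F)
    ultimately show "((\<lambda>x. f t *\<^sub>R g (x - t)) has_derivative blinfun_apply (F x t)) (at x within UNIV)"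
      by simp
  next
    fix x show "(\<lambda>t. f t *\<^sub>R g (x - t)) integrable_on cbox a b"
      using continuous_conv_integrand[OF f cg(1)] continuous_on_subset
      by (intro integrable_continuous) blast
  qed auto
  moreover have "(\<lambda>x. integral (cbox a b) (\<lambda>t. f t *\<^sub>R g (x - t))) = conv f g"
    using conv_eq_integral_cbox[OF f cg(1) supp] by auto
  moreover have "blinfun_apply (integral (cbox a b) (F x)) = (\<lambda>h. h \<bullet> conv f (grad g) x)"
  proof
    fix h
    have "blinfun_apply (integral (cbox a b) (F x)) h = integral (cbox a b) (\<lambda>t. blinfun_apply (F x t) h)"
      by (rule blinfun_apply_integral) (intro integrable_continuous cF1)
    also have "\<dots> = integral (cbox a b) (\<lambda>t. h \<bullet> (f t *\<^sub>R grad g (x - t)))"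
      by (simp only: F)
    also have "\<dots> = h \<bullet> integral (cbox a b) (\<lambda>t. f t *\<^sub>R grad g (x - t))"
    proof -
      have "(\<lambda>t. f t *\<^sub>R grad g (x - t)) integrable_on cbox a b"
        using continuous_conv_integrand[OF f cg(2)] continuous_on_subset
        by (intro integrable_continuous) blast
      from integral_linear[OF this bounded_linear_inner_right, of h] show ?thesis
        by (simp add: o_def)
    qed
    also have "\<dots> = h \<bullet> conv f (grad g) x"
      using conv_eq_integral_cbox[OF f cg(2) supp] by simp
    finally show "blinfun_apply (integral (cbox a b) (F x)) h = h \<bullet> conv f (grad g) x" .
  qed
  ultimately show ?thesis by (simp add: gderiv_def)
qed

section \<open>Smooth functions\<close>

lemma Ck_SucI:
  assumes "\<And>x. GDERIV f x :> D x" "\<And>b. b \<in> Basis \<Longrightarrow> Ck k (\<lambda>x. D x \<bullet> b)"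
  shows "Ck (Suc k) f"
  using assms grad_eq[OF assms(1)] by auto

lemma Ck_SucD: "Ck (Suc k) f \<Longrightarrow> GDERIV f x :> grad f x"
  using grad_eq by (metis Ck.simps(2))

lemma Ck_Suc_partial: "Ck (Suc k) f \<Longrightarrow> b \<in> Basis \<Longrightarrow> Ck k (\<lambda>x. grad f x \<bullet> b)"
  by simp

lemma Ck_mono: "Ck (Suc k) f \<Longrightarrow> Ck k f"
proof (induction k arbitrary: f)
  case 0
  then show ?case
    using GDERIV_isCont Ck_SucD continuous_at_imp_continuous_on by (metis Ck.simps(1))
next
  case (Suc k)
  show ?case
    by (rule Ck_SucI[OF Ck_SucD[OF Suc.prems] Suc.IH[OF Ck_Suc_partial[OF Suc.prems]]])
qed

lemma Ck_const: "Ck k (\<lambda>x. c)"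
proof (induction k arbitrary: c)
  case (Suc k)
  show ?case by (rule Ck_SucI[where D = "\<lambda>_. 0"]) (auto intro: GDERIV_const Suc)
qed simp

lemma Ck_inner: "Ck k (\<lambda>x. x \<bullet> b)"
proof (cases k)
  case (Suc j)
  show ?thesis unfolding Suc
    by (rule Ck_SucI[where D = "\<lambda>_. b"])
      (auto simp: gderiv_def intro!: Ck_const derivative_eq_intros)
qed (auto intro!: continuous_intros)

lemma Ck_add: "Ck k f \<Longrightarrow> Ck k g \<Longrightarrow> Ck k (\<lambda>x. f x + g x)"
proof (induction k arbitrary: f g)
  case (Suc k)
  show ?case
    by (rule Ck_SucI[OF GDERIV_add[OF Ck_SucD[OF Suc.prems(1)] Ck_SucD[OF Suc.prems(2)]]])
      (use Suc in \<open>simp add: inner_add_left\<close>)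
qed (auto intro!: continuous_intros)

lemma Ck_mult: "Ck k f \<Longrightarrow> Ck k g \<Longrightarrow> Ck k (\<lambda>x. f x * g x)"
proof (induction k arbitrary: f g)
  case (Suc k)
  have *: "Ck k f" "Ck k g" using Suc.prems Ck_mono by blast+
  show ?case
    by (rule Ck_SucI[OF GDERIV_mult[OF Ck_SucD[OF Suc.prems(1)] Ck_SucD[OF Suc.prems(2)]]])
      (simp only: inner_add_left inner_scaleR_left, intro Ck_add Suc.IH *; use Suc.prems in simp)
qed (auto intro!: continuous_intros)

lemma Ck_imp_C1_on: "\<forall>k. Ck k f \<Longrightarrow> C1_on UNIV f"
  unfolding C1_on_def
proof safe
  assume *: "\<forall>k. Ck k f"
  then show "\<And>x. \<exists>D. GDERIV f x :> D" using Ck_SucD by blast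
  have "continuous_on UNIV (\<lambda>x. \<Sum>b\<in>Basis. (grad f x \<bullet> b) *\<^sub>R b)"
    using * Ck_Suc_partial[of 0 f]
    by (intro continuous_on_sum continuous_on_scaleR continuous_on_const) simp
  then show "continuous_on UNIV (grad f)" by (simp add: euclidean_representation)
qed

lemma Ck_conv:
  assumes f: "continuous_on UNIV f" and K: "compact K" "\<And>t. t \<notin> K \<Longrightarrow> f t = 0"
    and "\<forall>j. Ck j g"
  shows "Ck k (conv f g)"
  using assms(4)
proof (induction k arbitrary: g)
  case 0
  then show ?case
    using GDERIV_conv[OF f K Ck_imp_C1_on] GDERIV_isCont continuous_at_imp_continuous_on
    by (metis Ck.simps(1))
next
  case (Suc k)
  have g: "C1_on UNIV g" using Suc.prems Ck_imp_C1_on by blast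
  show ?case
  proof (rule Ck_SucI[OF GDERIV_conv[OF f K g]])
    fix b :: 'a assume "b \<in> Basis"
    then have "\<forall>j. Ck j (\<lambda>x. grad g x \<bullet> b)" using Suc.prems Ck_Suc_partial by blast
    then have "Ck k (conv f (\<lambda>x. grad g x \<bullet> b))" by (rule Suc.IH)
    moreover have "conv f (\<lambda>x. grad g x \<bullet> b) = (\<lambda>x. conv f (grad g) x \<bullet> b)"
    proof
      fix x
      have "integrable lborel (\<lambda>t. f t *\<^sub>R grad g (x - t))"
        using integrable_conv_integrand[OF f C1_on_cont_grad[OF g] K] .
      from integral_inner_left[OF this, of b]
      show "conv f (\<lambda>x. grad g x \<bullet> b) x = conv f (grad g) x \<bullet> b"
        by (simp add: conv_def)
    qed
    ultimately show "Ck k (\<lambda>x. conv f (grad g) x \<bullet> b)" by simp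
  qed
qed

text \<open>The functions \<open>t powr (- n) * exp (- 1 / t)\<close> on the positive half-line, extended by 0.  The span of
this family is closed under differentiation, which gives the smoothness of all its members at once.\<close>

definition flat :: "nat \<Rightarrow> real \<Rightarrow> real" where
  "flat n t = (if t > 0 then (1 / t) ^ n * exp (- (1 / t)) else 0)"

lemma flat_tendsto: "(flat n \<longlongrightarrow> 0) (at 0)"
proof -
  have "((\<lambda>x::real. x ^ n / exp x) \<longlongrightarrow> 0) at_top" by (rule tendsto_power_div_exp_0)
  then have "((\<lambda>t::real. inverse t ^ n / exp (inverse t)) \<longlongrightarrow> 0) (at_right 0)"
    by (rule filterlim_compose[OF _ filterlim_inverse_at_top_right])
  moreover have "\<forall>\<^sub>F t in at_right 0. inverse t ^ n / exp (inverse t) = flat n t"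
    using eventually_at_right_less by (rule eventually_mono)
      (simp add: flat_def divide_inverse exp_minus)
  ultimately have R: "(flat n \<longlongrightarrow> 0) (at_right 0)" by (rule Lim_transform_eventually)
  have "\<forall>\<^sub>F t in at_left (0::real). 0 = flat n t"
    by (rule eventually_mono[OF eventually_at_left_real[of "-1" "0::real"]]) (auto simp: flat_def)
  then have "(flat n \<longlongrightarrow> 0) (at_left 0)" by (rule Lim_transform_eventually[OF tendsto_const])
  with R show ?thesis by (simp add: filterlim_split_at)
qed

lemma flat_deriv: "(flat n has_real_derivative flat (n + 2) t - n * flat (n + 1) t) (at t)"
proof (cases "t = 0")
  case True
  have "((\<lambda>h. (flat n (0 + h) - flat n 0) / h) \<longlongrightarrow> 0) (at 0)"
  proof (rule Lim_transform_eventually[OF flat_tendsto[of "Suc n"]])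
    show "\<forall>\<^sub>F h in at 0. flat (Suc n) h = (flat n (0 + h) - flat n 0) / h"
      by (rule always_eventually) (auto simp: flat_def)
  qed
  then show ?thesis unfolding True DERIV_def by (simp add: flat_def)
next
  case t: False
  show ?thesis
  proof (cases "t > 0")
    case True
    have "((\<lambda>t. (1 / t) ^ n * exp (- (1 / t))) has_real_derivative
        flat (n + 2) t - n * flat (n + 1) t) (at t)"
    proof -
      let ?s = "1 / t"
      have "((\<lambda>s. s ^ n * exp (- s)) has_real_derivative (n * ?s ^ (n - 1) - ?s ^ n) * exp (- ?s)) (at ?s)"
        by (auto intro!: derivative_eq_intros simp: algebra_simps)
      moreover have "((\<lambda>t. 1 / t) has_real_derivative - ?s\<^sup>2) (at t)"
        using t by (auto intro!: derivative_eq_intros simp: power2_eq_square)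
      ultimately have "((\<lambda>t. (1 / t) ^ n * exp (- (1 / t))) has_real_derivative
          (n * ?s ^ (n - 1) - ?s ^ n) * exp (- ?s) * - ?s\<^sup>2) (at t)"
        by (rule DERIV_chain2)
      also have "(n * ?s ^ (n - 1) - ?s ^ n) * exp (- ?s) * - ?s\<^sup>2 = flat (n + 2) t - n * flat (n + 1) t"
        using True by (cases n) (simp_all add: flat_def power2_eq_square algebra_simps add_divide_distrib)
      finally show ?thesis .
    qed
    then show ?thesis
      by (rule has_field_derivative_transform_within_open[of _ _ _ "{0<..}"])
        (use True in \<open>auto simp: flat_def\<close>)
  next
    case False
    have "((\<lambda>t. 0) has_real_derivative flat (n + 2) t - n * flat (n + 1) t) (at t)"
      using False by (simp add: flat_def)
    then show ?thesis
      by (rule has_field_derivative_transform_within_open[of _ _ _ "{..<0}"])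
        (use False t in \<open>auto simp: flat_def\<close>)
  qed
qed

lemma Ck_flat: "Ck k (\<lambda>x::'a::euclidean_space. flat n (e - x \<bullet> x))"
proof (induction k arbitrary: n)
  case 0
  have "continuous_on UNIV (flat n)"
    using flat_deriv DERIV_isCont continuous_at_imp_continuous_on by blast
  then show ?case
    by (auto intro!: continuous_intros continuous_on_compose2[of UNIV "flat n"])
next
  case (Suc k)
  let ?d = "\<lambda>x::'a. flat (n + 2) (e - x \<bullet> x) + (- real n) * flat (n + 1) (e - x \<bullet> x)"
  show ?case
  proof (rule Ck_SucI[where D = "\<lambda>x. ?d x *\<^sub>R ((-2) *\<^sub>R x)"])
    fix x :: 'a
    have "GDERIV (\<lambda>x. e - x \<bullet> x) x :> (-2) *\<^sub>R x"
      unfolding gderiv_def by (auto intro!: derivative_eq_intros simp: inner_commute)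
    from GDERIV_DERIV_compose[OF this flat_deriv]
    show "GDERIV (\<lambda>x. flat n (e - x \<bullet> x)) x :> ?d x *\<^sub>R ((-2) *\<^sub>R x)" by simp
  next
    fix b :: 'a
    have "Ck k (\<lambda>x. ?d x * ((-2) * (x \<bullet> b)))"
      by (intro Ck_mult Ck_add Ck_const Ck_inner Suc.IH)
    then show "Ck k (\<lambda>x. (?d x *\<^sub>R ((-2) *\<^sub>R x)) \<bullet> b)"
      by (simp only: inner_scaleR_left)
  qed
qed

section \<open>Test functions of class C1\<close>

lemma set_integrable_compact:
  fixes h :: "'a::euclidean_space \<Rightarrow> 'b::euclidean_space"
  assumes "compact K" "continuous_on K h"
  shows "set_integrable lborel K h"
  unfolding set_integrable_def by (rule borel_integrable_compact[OF assms])

lemma set_integral_restrict: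
  assumes "K \<subseteq> S" "\<And>x. x \<in> S - K \<Longrightarrow> h x = 0"
  shows "set_lebesgue_integral M S h = set_lebesgue_integral M K h"
  unfolding set_lebesgue_integral_def
  by (rule Bochner_Integration.integral_cong) (use assms in \<open>auto simp: indicator_def\<close>)

lemma grad_eq_0_off_support:
  assumes "closed K" "\<And>x. x \<notin> K \<Longrightarrow> f x = 0" "x \<notin> K"
  shows "grad f x = 0"
proof (rule grad_eq)
  have "((\<lambda>x. 0) has_derivative (\<lambda>h. 0)) (at x)" by simp
  then have "(f has_derivative (\<lambda>h. 0)) (at x)"
    by (rule has_derivative_transform_within_open[of _ _ _ _ "- K"])
      (use assms in auto)
  then show "GDERIV f x :> 0" by (simp add: gderiv_def)
qed

lemma integral_zero_imp_zero:
  fixes f :: "'a::euclidean_space \<Rightarrow> real"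
  assumes f: "continuous_on UNIV f" and K: "compact K" "\<And>x. x \<notin> K \<Longrightarrow> f x = 0"
    and nonneg: "\<And>x. f x \<ge> 0" and int: "(LINT x|lborel. f x) \<le> 0"
  shows "f x = 0"
proof -
  obtain a b where ab: "insert x K \<subseteq> box a b"
    using K(1) bounded_subset_box_symmetric[of "insert x K"] compact_imp_bounded by (metis bounded_insert)
  have I: "integrable lborel f" by (rule integrable_continuous_compact_support[OF f K])
  have "(LINT x|lborel. f x) = 0"
    using int Bochner_Integration.integral_nonneg[of lborel f] nonneg by fastforce
  then have "(f has_integral 0) UNIV" using has_integral_integral_lborel[OF I] by simp
  moreover have "f = (\<lambda>x. if x \<in> cbox a b then f x else 0)"
    using K(2) ab box_subset_cbox by fastforce
  ultimately have "(f has_integral 0) (cbox a b)"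
    using has_integral_restrict_UNIV[of "cbox a b" f 0] by metis
  moreover have "continuous_on (cbox a b) f" using f continuous_on_subset by blast
  moreover have "x \<in> cbox a b" "box a b \<noteq> {}" using ab box_subset_cbox by auto
  ultimately show ?thesis using has_integral_0_cbox_imp_0[of a b f x] nonneg by blast
qed

lemma compact_thickening:
  fixes K :: "'a::euclidean_space set"
  assumes "compact K" "open S" "K \<subseteq> S"
  obtains d K' where "0 < d" "compact K'" "K \<subseteq> K'" "K' \<subseteq> S"
    "\<And>x y. x \<in> K \<Longrightarrow> norm y \<le> d \<Longrightarrow> x + y \<in> K'"
proof -
  obtain e where e: "e > 0" "(\<Union>x\<in>K. cball x e) \<subseteq> S"
    using compact_subset_open_imp_cball_epsilon_subset[OF assms] .
  define K' where "K' = {x + y | x y. x \<in> K \<and> y \<in> cball 0 e}"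
  have "compact K'" unfolding K'_def by (intro compact_sums compact_cball assms(1))
  moreover have sum: "x + y \<in> K'" if "x \<in> K" "norm y \<le> e" for x y
    using that by (auto simp: K'_def)
  moreover have "K \<subseteq> K'" using sum[of _ 0] e(1) by auto
  moreover have "K' \<subseteq> (\<Union>x\<in>K. cball x e)" by (force simp: K'_def dist_norm)
  ultimately show ?thesis using that[of e K'] e by blast
qed

text \<open>A smooth mollifier supported in the ball of radius \<open>e\<close> about 0; it is not normalised to have integral 1.\<close>

definition kernel :: "real \<Rightarrow> 'a::euclidean_space \<Rightarrow> real" where
  "kernel e x = flat 0 (e\<^sup>2 - x \<bullet> x)"

lemma Ck_kernel: "Ck k (kernel e)"
  using Ck_flat unfolding kernel_def .

lemma kernel_nonneg: "kernel e x \<ge> 0"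
  by (simp add: kernel_def flat_def)

lemma kernel_support: "0 < e \<Longrightarrow> x \<notin> cball 0 e \<Longrightarrow> kernel e x = 0"
  using power_strict_mono[of e "norm x" 2]
  by (simp add: kernel_def flat_def dot_square_norm)

lemma kernel_integral_pos:
  assumes "0 < e"
  shows "(LINT x|lborel. kernel e (x :: 'a::euclidean_space)) > 0"
proof (rule ccontr)
  assume "\<not> ?thesis"
  moreover have "continuous_on UNIV (kernel e :: 'a \<Rightarrow> real)" using Ck_kernel[of 0] by simp
  ultimately have "kernel e (0 :: 'a) = 0"
    using kernel_support[OF assms]
    by (intro integral_zero_imp_zero[of "kernel e" "cball 0 e" 0] kernel_nonneg) auto
  then show False using assms by (simp add: kernel_def flat_def)
qed

text \<open>The weak inequality passes from smooth test functions to C1 ones.  Since \<open>kernel e\<close> has some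
integral \<open>c > 0\<close>, the gradient of the mollified function is close to \<open>c *\<^sub>R grad \<phi>\<close>, uniformly and up to
an error that is small compared with \<open>c\<close>; as the inequality is homogeneous, \<open>c\<close> does no harm.\<close>

lemma weak_ineq_C1_test:
  fixes F :: "'a::euclidean_space \<Rightarrow> 'a"
  assumes \<Omega>: "open \<Omega>" and F: "continuous_on \<Omega> F"
    and weak: "\<And>\<psi>. test_function \<Omega> \<psi> \<Longrightarrow> (\<And>x. \<psi> x \<ge> 0) \<Longrightarrow> (LINT x:\<Omega>|lborel. F x \<bullet> grad \<psi> x) \<ge> 0"
    and \<phi>: "C1_on UNIV \<phi>" "\<And>x. \<phi> x \<ge> 0"
    and K: "compact K" "K \<subseteq> \<Omega>" "\<And>x. x \<notin> K \<Longrightarrow> \<phi> x = 0"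
  shows "(LINT x:\<Omega>|lborel. F x \<bullet> grad \<phi> x) \<ge> 0"
proof (rule ccontr)
  define J where "J = (LINT x:\<Omega>|lborel. F x \<bullet> grad \<phi> x)"
  assume "\<not> ?thesis"
  then have J: "J < 0" by (simp add: J_def)
  have c\<phi>: "continuous_on UNIV \<phi>" "continuous_on UNIV (grad \<phi>)"
    using \<phi>(1) C1_on_cont C1_on_cont_grad by auto
  obtain d K1 where d: "d > 0" and K1: "compact K1" and KK1: "K \<subseteq> K1" and K1\<Omega>: "K1 \<subseteq> \<Omega>"
    and sum1: "\<And>x y. x \<in> K \<Longrightarrow> norm y \<le> d \<Longrightarrow> x + y \<in> K1"
    using compact_thickening[OF K(1) \<Omega> K(2)] by blast
  define K2 where "K2 = {x + y | x y. x \<in> K1 \<and> y \<in> cball 0 d}"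
  have K2: "compact K2" unfolding K2_def by (intro compact_sums compact_cball K1)
  have FK1: "continuous_on K1 F" using F K1\<Omega> continuous_on_subset by blast
  obtain M where M: "M > 0" "\<And>x. x \<in> K1 \<Longrightarrow> norm (F x) \<le> M"
    using compact_imp_bounded[OF compact_continuous_image[OF FK1 K1]] unfolding bounded_pos by auto
  define V where "V = measure lborel K1"
  have V: "V \<ge> 0" by (simp add: V_def)
  \<comment> \<open>The admissible error for the gradient, chosen so that \<open>J + M * \<omega> * V\<close> is still negative.\<close>
  define \<omega> where "\<omega> = - J / (2 * (M * V + 1))"
  have MV: "M * V \<ge> 0" using M V by simp
  have \<omega>: "\<omega> > 0" unfolding \<omega>_def by (rule divide_pos_pos) (use J MV in auto)
  have small: "J + M * \<omega> * V < 0"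
  proof -
    have "\<omega> * (2 * (M * V + 1)) = - J" unfolding \<omega>_def using MV by simp
    then have "J + M * \<omega> * V = - (\<omega> * (M * V)) - 2 * \<omega>" by (simp add: algebra_simps)
    also have "\<dots> < 0" using \<omega> mult_nonneg_nonneg[OF less_imp_le[OF \<omega>] MV] by linarith
    finally show ?thesis .
  qed
  have "uniformly_continuous_on K2 (grad \<phi>)"
    using compact_uniformly_continuous[OF _ K2] c\<phi>(2) continuous_on_subset by blast
  then obtain d' where d': "d' > 0"
      "\<And>x x'. x \<in> K2 \<Longrightarrow> x' \<in> K2 \<Longrightarrow> dist x' x < d' \<Longrightarrow> dist (grad \<phi> x') (grad \<phi> x) < \<omega>"
    unfolding uniformly_continuous_on_def using \<omega> by meson
  define e where "e = min d (d' / 2)"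
  have e: "e > 0" "e \<le> d" "e < d'" using d d' by (auto simp: e_def)
  define \<rho> :: "'a \<Rightarrow> real" where "\<rho> = kernel e"
  have \<rho>0: "continuous_on UNIV \<rho>" using Ck_kernel[of 0] unfolding \<rho>_def by simp
  have \<rho>: "\<And>x. \<rho> x \<ge> 0" "\<And>x. x \<notin> cball 0 e \<Longrightarrow> \<rho> x = 0"
    unfolding \<rho>_def using kernel_nonneg kernel_support[OF e(1)] by auto
  define c where "c = (LINT x|lborel. \<rho> x)"
  have c: "c > 0" unfolding c_def \<rho>_def by (rule kernel_integral_pos[OF e(1)])
  define \<psi> where "\<psi> = conv \<rho> \<phi>"
  have \<psi>': "\<psi> = conv \<phi> \<rho>" unfolding \<psi>_def using conv_commute[OF \<rho>0 c\<phi>(1)] by auto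
  have Ck\<psi>: "Ck k \<psi>" for k
    unfolding \<psi>' by (rule Ck_conv[OF c\<phi>(1) K(1,3)]) (auto simp: \<rho>_def Ck_kernel)
  have \<psi>0: "\<psi> x \<ge> 0" for x
    unfolding \<psi>_def conv_def using \<rho> \<phi>(2) by (intro Bochner_Integration.integral_nonneg) simp
  have \<psi>K1: "\<psi> x = 0" if "x \<notin> K1" for x
  proof -
    have "\<rho> t *\<^sub>R \<phi> (x - t) = 0" for t
    proof (cases "t \<in> cball 0 e")
      case True
      then have "x - t \<notin> K" using that e(2) sum1[of "x - t" t] by auto
      then show ?thesis using K(3) by simp
    qed (use \<rho> in simp)
    then have zero: "(\<lambda>t. \<rho> t *\<^sub>R \<phi> (x - t)) = (\<lambda>t. 0)" by blast
    show ?thesis unfolding \<psi>_def conv_def zero by simp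
  qed
  have "closure {x. \<psi> x \<noteq> 0} \<subseteq> K1"
    by (rule closure_minimal) (use \<psi>K1 K1 compact_imp_closed in auto)
  then have "test_function \<Omega> \<psi>"
    unfolding test_function_def using Ck\<psi> K1\<Omega> K1 by (meson closed_closure compact_closure
        bounded_subset closure_subset compact_imp_bounded order_trans)
  then have I: "(LINT x:\<Omega>|lborel. F x \<bullet> grad \<psi> x) \<ge> 0" using weak \<psi>0 by blast
  have grad\<psi>: "grad \<psi> x = conv \<rho> (grad \<phi>) x" for x
    unfolding \<psi>_def by (rule grad_eq, rule GDERIV_conv[OF \<rho>0 compact_cball \<rho>(2) \<phi>(1)])
  have off: "grad \<psi> x = 0" "grad \<phi> x = 0" if "x \<notin> K1" for x
    using grad_eq_0_off_support[of K1 _ x] K1 compact_imp_closed \<psi>K1 K(3) KK1 that by blast+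
  have close: "norm (grad \<psi> x - c *\<^sub>R grad \<phi> x) \<le> c * \<omega>" if x: "x \<in> K1" for x
  proof -
    have i1: "integrable lborel (\<lambda>t. \<rho> t *\<^sub>R grad \<phi> (x - t))"
      by (rule integrable_conv_integrand[OF \<rho>0 c\<phi>(2) compact_cball \<rho>(2)])
    have i\<rho>: "integrable lborel \<rho>"
      by (rule integrable_continuous_compact_support[OF \<rho>0 compact_cball \<rho>(2)])
    have "grad \<psi> x - c *\<^sub>R grad \<phi> x = (LINT t|lborel. \<rho> t *\<^sub>R grad \<phi> (x - t) - \<rho> t *\<^sub>R grad \<phi> x)"
      unfolding grad\<psi> conv_def c_def using i1 i\<rho> by simp
    also have "norm \<dots> \<le> (LINT t|lborel. norm (\<rho> t *\<^sub>R grad \<phi> (x - t) - \<rho> t *\<^sub>R grad \<phi> x))"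
      by (rule integral_norm_bound)
    also have "\<dots> \<le> (LINT t|lborel. \<rho> t * \<omega>)"
    proof (rule integral_mono)
      show "integrable lborel (\<lambda>t. norm (\<rho> t *\<^sub>R grad \<phi> (x - t) - \<rho> t *\<^sub>R grad \<phi> x))"
        using i1 i\<rho> by simp
      show "integrable lborel (\<lambda>t. \<rho> t * \<omega>)" using i\<rho> by simp
      fix t
      show "norm (\<rho> t *\<^sub>R grad \<phi> (x - t) - \<rho> t *\<^sub>R grad \<phi> x) \<le> \<rho> t * \<omega>"
      proof (cases "t \<in> cball 0 e")
        case True
        have "x \<in> K2" unfolding K2_def using x d by (intro CollectI exI[of _ x] exI[of _ 0]) auto
        moreover have "x - t \<in> K2" unfolding K2_def using x True e(2)
          by (intro CollectI exI[of _ x] exI[of _ "- t"]) auto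
        moreover have "dist (x - t) x < d'" using True e by (simp add: dist_norm)
        ultimately have "dist (grad \<phi> (x - t)) (grad \<phi> x) < \<omega>" by (rule d'(2))
        then show ?thesis using \<rho>(1)[of t]
          by (simp add: dist_norm mult_left_mono flip: scaleR_diff_right)
      qed (use \<rho> in simp)
    qed
    also have "\<dots> = c * \<omega>" by (simp add: c_def)
    finally show ?thesis .
  qed
  have cont: "continuous_on K1 (\<lambda>x. F x \<bullet> grad \<phi> x)" "continuous_on K1 (\<lambda>x. F x \<bullet> grad \<psi> x)"
    using FK1 c\<phi>(2) C1_on_cont_grad[OF Ck_imp_C1_on] Ck\<psi>
    by (auto intro!: continuous_on_inner intro: continuous_on_subset)
  note int = cont[THEN set_integrable_compact[OF K1]]
  have J1: "J = (LINT x:K1|lborel. F x \<bullet> grad \<phi> x)"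
    unfolding J_def by (rule set_integral_restrict[OF K1\<Omega>]) (simp add: off)
  have I1: "(LINT x:\<Omega>|lborel. F x \<bullet> grad \<psi> x) = (LINT x:K1|lborel. F x \<bullet> grad \<psi> x)"
    by (rule set_integral_restrict[OF K1\<Omega>]) (simp add: off)
  have fin: "emeasure lborel K1 \<noteq> \<infinity>" using emeasure_compact_finite[OF K1] by auto
  have "(LINT x:K1|lborel. F x \<bullet> grad \<psi> x) \<le> (LINT x:K1|lborel. c * (F x \<bullet> grad \<phi> x) + M * (c * \<omega>))"
  proof (rule set_integral_mono[OF int(2)])
    show "set_integrable lborel K1 (\<lambda>x. c * (F x \<bullet> grad \<phi> x) + M * (c * \<omega>))"
      by (intro set_integrable_compact K1 continuous_intros cont)
    fix x assume x: "x \<in> K1"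
    have "F x \<bullet> (grad \<psi> x - c *\<^sub>R grad \<phi> x) \<le> norm (F x) * norm (grad \<psi> x - c *\<^sub>R grad \<phi> x)"
      by (rule norm_cauchy_schwarz)
    also have "\<dots> \<le> M * (c * \<omega>)"
      by (intro mult_mono M close x) (use M in auto)
    finally show "F x \<bullet> grad \<psi> x \<le> c * (F x \<bullet> grad \<phi> x) + M * (c * \<omega>)"
      by (simp add: inner_diff_right)
  qed
  also have "\<dots> = c * J + V * (M * (c * \<omega>))"
  proof -
    have "set_integrable lborel K1 (\<lambda>_. M * (c * \<omega>))"
      by (intro set_integrable_compact K1 continuous_intros)
    moreover have "set_integrable lborel K1 (\<lambda>x. c * (F x \<bullet> grad \<phi> x))"
      using int(1) by simp
    ultimately show ?thesis
      using fin K1 by (simp add: set_integral_add set_integral_const J1 V_def compact_imp_closed borel_closed)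
  qed
  also have "\<dots> = c * (J + M * \<omega> * V)" by (simp add: algebra_simps)
  also have "\<dots> < 0" using c small by (simp add: mult_pos_neg)
  finally show False using I I1 by simp
qed

section \<open>The vector field of the p-Laplacian\<close>

lemma norm_plap_field: "norm (plap_field q v) = norm v powr (q - 1)"
proof (cases "v = 0")
  case False
  have "norm v powr (q - 1) = norm v powr (q - 2) * norm v powr 1"
    unfolding powr_add[symmetric] by simp
  then show ?thesis using False by (simp add: plap_field_def)
qed (simp add: plap_field_def)

text \<open>At zeros of \<open>v\<close> the continuity rests on \<open>norm (plap_field q v) = norm v powr (q - 1)\<close> and on \<open>q > 1\<close>;
the scalar factor of \<open>plap_field\<close> itself is unbounded there if \<open>q < 2\<close>.\<close>

lemma continuous_on_plap_field:
  assumes p: "continuous_on S p" "\<And>x. x \<in> S \<Longrightarrow> p x > 1" and v: "continuous_on S v"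
  shows "continuous_on S (\<lambda>x. plap_field (p x) (v x))"
  unfolding continuous_on_def
proof
  fix x assume x: "x \<in> S"
  have pt: "(p \<longlongrightarrow> p x) (at x within S)" and vt: "(v \<longlongrightarrow> v x) (at x within S)"
    using p(1) v x by (auto simp: continuous_on_def)
  show "((\<lambda>x. plap_field (p x) (v x)) \<longlongrightarrow> plap_field (p x) (v x)) (at x within S)"
  proof (cases "v x = 0")
    case True
    have "((\<lambda>x. norm (v x) powr (p x - 1)) \<longlongrightarrow> 0) (at x within S)"
    proof (rule tendsto_zero_powrI)
      show "((\<lambda>x. norm (v x)) \<longlongrightarrow> 0) (at x within S)" using tendsto_norm[OF vt] True by simp
      show "((\<lambda>x. p x - 1) \<longlongrightarrow> p x - 1) (at x within S)" by (intro tendsto_intros pt)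
    qed (use p(2)[OF x] in auto)
    then have "((\<lambda>x. plap_field (p x) (v x)) \<longlongrightarrow> 0) (at x within S)"
      unfolding norm_plap_field[symmetric] by (rule tendsto_norm_zero_cancel)
    then show ?thesis using True by (simp add: plap_field_def)
  next
    case False
    then show ?thesis unfolding plap_field_def by (intro tendsto_intros vt pt) auto
  qed
qed

lemma plap_field_strict_mono:
  fixes a b :: "'a::euclidean_space"
  assumes q: "q > 1"
  shows "(plap_field q a - plap_field q b) \<bullet> (a - b) \<ge> 0"
    and "(plap_field q a - plap_field q b) \<bullet> (a - b) = 0 \<Longrightarrow> a = b"
proof -
  define A B where "A = norm a powr (q - 2)" and "B = norm b powr (q - 2)"
  have pos: "A \<ge> 0" "B \<ge> 0" by (auto simp: A_def B_def)
  have A: "A * norm a = norm a powr (q - 1)" and B: "B * norm b = norm b powr (q - 1)"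
    using norm_plap_field[of q a] norm_plap_field[of q b] by (auto simp: plap_field_def A_def B_def)
  \<comment> \<open>Both summands are nonnegative: powers are increasing, and the Cauchy-Schwarz inequality.\<close>
  have eq: "(plap_field q a - plap_field q b) \<bullet> (a - b)
      = (A * norm a - B * norm b) * (norm a - norm b) + (A + B) * (norm a * norm b - a \<bullet> b)"
    by (simp add: plap_field_def A_def B_def inner_diff_left inner_diff_right algebra_simps
        dot_square_norm power2_eq_square inner_commute)
  have le: "a \<bullet> b \<le> norm a * norm b" by (rule norm_cauchy_schwarz)
  have less: "s powr (q - 1) < t powr (q - 1)" if "0 \<le> s" "s < t" for s t :: real
    using powr_less_mono2[of "q - 1" s t] q that by simp
  have 1: "(A * norm a - B * norm b) * (norm a - norm b) \<ge> 0"
    unfolding A B using less[of "norm a" "norm b"] less[of "norm b" "norm a"]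
    by (cases "norm a" "norm b" rule: linorder_cases) (auto intro: mult_nonpos_nonpos)
  have 2: "(A + B) * (norm a * norm b - a \<bullet> b) \<ge> 0" using pos le by simp
  show "(plap_field q a - plap_field q b) \<bullet> (a - b) \<ge> 0" unfolding eq using 1 2 by simp
  assume "(plap_field q a - plap_field q b) \<bullet> (a - b) = 0"
  then have z: "(A * norm a - B * norm b) * (norm a - norm b) = 0"
      "(A + B) * (norm a * norm b - a \<bullet> b) = 0"
    unfolding eq using 1 2 by linarith+
  have n: "norm a = norm b"
    using z(1) less[of "norm a" "norm b"] less[of "norm b" "norm a"] unfolding A B
    by (cases "norm a" "norm b" rule: linorder_cases) auto
  show "a = b"
  proof (cases "a = 0")
    case True
    then show ?thesis using n by simp
  next
    case False
    then have "A + B > 0" using pos by (simp add: A_def add_pos_nonneg B_def)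
    then have "a \<bullet> b = norm a * norm b" using z(2) by simp
    then have "norm a *\<^sub>R b = norm b *\<^sub>R a" by (simp only: norm_cauchy_schwarz_eq)
    then show ?thesis using n False by auto
  qed
qed

section \<open>Radial vector fields and dilations\<close>

text \<open>A field \<open>H x *\<^sub>R (x - z)\<close> has weakly nonpositive divergence as soon as \<open>norm (x - z) ^ DIM('a) * H x\<close>
does not increase along the rays from \<open>z\<close>, which is the hypothesis \<open>mono\<close>; no differentiability of \<open>H\<close> is needed.  Indeed
\<open>(x - z) \<bullet> grad \<phi> x\<close> is the derivative at \<open>l = 1\<close> of \<open>\<phi> (z + l *\<^sub>R (x - z))\<close>, and after the
substitution \<open>y = z + l *\<^sub>R (x - z)\<close> the hypothesis yields that \<open>\<integral> H x * \<phi> (z + l *\<^sub>R (x - z))\<close>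
is, for \<open>l > 1\<close> close to 1, at least its value for \<open>l = 1\<close>.\<close>

lemma radial_field_dilation:
  fixes H :: "'a::euclidean_space \<Rightarrow> real"
  assumes A: "open A" and H: "continuous_on A H"
    and mono: "\<And>l x. l > 1 \<Longrightarrow> x \<in> A \<Longrightarrow> z + (x - z) /\<^sub>R l \<in> A \<Longrightarrow>
      H x \<le> H (z + (x - z) /\<^sub>R l) / l ^ DIM('a)"
    and \<phi>: "C1_on UNIV \<phi>" "\<And>x. \<phi> x \<ge> 0"
    and K: "compact K" "K \<subseteq> A" "\<And>x. x \<notin> K \<Longrightarrow> \<phi> x = 0"
  shows "(LINT x:A|lborel. H x * ((x - z) \<bullet> grad \<phi> x)) \<ge> 0"
proof -
  have c\<phi>: "continuous_on UNIV \<phi>" "continuous_on UNIV (grad \<phi>)"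
    using \<phi>(1) C1_on_cont C1_on_cont_grad by auto
  obtain d K1 where d: "d > 0" and K1: "compact K1" and KK1: "K \<subseteq> K1" and K1A: "K1 \<subseteq> A"
    and sum1: "\<And>x y. x \<in> K \<Longrightarrow> norm y \<le> d \<Longrightarrow> x + y \<in> K1"
    using compact_thickening[OF K(1) A K(2)] by blast
  have HK1: "continuous_on K1 H" using H K1A continuous_on_subset by blast
  obtain B where B: "B > 0" "\<And>x. x \<in> K1 \<Longrightarrow> norm (x - z) \<le> B"
  proof -
    have "bounded ((\<lambda>x. x - z) ` K1)"
      by (intro compact_imp_bounded compact_continuous_image continuous_intros K1)
    then show ?thesis using that unfolding bounded_pos by auto
  qed
  obtain C where C: "C > 0" "\<And>x. norm (grad \<phi> x) \<le> C"
  proof -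
    have "bounded (grad \<phi> ` K)"
      by (intro compact_imp_bounded compact_continuous_image K(1) continuous_on_subset[OF c\<phi>(2)]) auto
    then obtain C where "C > 0" "\<And>x. x \<in> K \<Longrightarrow> norm (grad \<phi> x) \<le> C" unfolding bounded_pos by auto
    moreover have "norm (grad \<phi> x) \<le> C" if "x \<notin> K" for x
      using grad_eq_0_off_support[of K \<phi> x] compact_imp_closed[OF K(1)] K(3) that \<open>C > 0\<close> by simp
    ultimately show ?thesis using that[of C] by blast
  qed
  have lip: "\<bar>\<phi> x - \<phi> y\<bar> \<le> C * norm (x - y)" for x y
  proof -
    have "norm (\<phi> x - \<phi> y) \<le> C * norm (x - y)"
    proof (rule differentiable_bound[of UNIV \<phi> "\<lambda>x h. h \<bullet> grad \<phi> x"])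
      show "(\<phi> has_derivative (\<lambda>h. h \<bullet> grad \<phi> x)) (at x within UNIV)" for x
        using C1_onD[OF \<phi>(1)] by (simp add: gderiv_def)
      show "onorm (\<lambda>h. h \<bullet> grad \<phi> x) \<le> C" for x
      proof (rule onorm_bound)
        fix h show "norm (h \<bullet> grad \<phi> x) \<le> C * norm h"
          using order_trans[OF Cauchy_Schwarz_ineq2[of h "grad \<phi> x"] mult_left_mono[OF C(2)]]
          by (simp add: mult.commute)
      qed (use C in simp)
    qed auto
    then show ?thesis by simp
  qed
  \<comment> \<open>\<open>H\<close> may blow up at the boundary of \<open>A\<close>; it is cut off outside a compact set that contains the
    supports of all dilates of \<open>\<phi>\<close> for \<open>1 < l \<le> 1 + \<delta>\<close>.\<close>
  define H1 where "H1 x = indicator K1 x * H x" for x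
  have int1: "integrable lborel (\<lambda>x. H1 x * g x)" if "continuous_on K1 g" for g :: "'a \<Rightarrow> real"
  proof -
    have "integrable lborel (\<lambda>x. indicator K1 x *\<^sub>R (H x * g x))"
      by (intro borel_integrable_compact K1 continuous_intros HK1 that)
    then show ?thesis by (simp add: H1_def mult.assoc)
  qed
  define \<delta> where "\<delta> = d / B"
  have \<delta>: "\<delta> > 0" using d B by (simp add: \<delta>_def)
  define T where "T l x = z + l *\<^sub>R (x - z)" for l x
  have cT: "continuous_on S (\<lambda>x. \<phi> (T l x))" for S l
    unfolding T_def by (intro continuous_on_compose2[OF c\<phi>(1)] continuous_intros) auto
  have key: "(LINT x|lborel. H1 x * (\<phi> (T l x) - \<phi> x)) \<ge> 0" if l: "1 < l" "l - 1 \<le> \<delta>" for l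
  proof -
    have near: "z + (y - z) /\<^sub>R l \<in> K1" if y: "y \<in> K" for y
    proof -
      have "z + (y - z) /\<^sub>R l = y + (1 / l - 1) *\<^sub>R (y - z)"
        by (simp add: algebra_simps divide_inverse)
      moreover have "norm ((1 / l - 1) *\<^sub>R (y - z)) \<le> d"
      proof -
        have "\<bar>1 / l - 1\<bar> = (l - 1) / l" using l by (simp add: field_simps abs_if)
        also have "\<dots> \<le> l - 1"
          using l mult_left_mono[of 1 l "l - 1"] by (simp add: divide_le_eq)
        also have "\<dots> \<le> \<delta>" by (rule l(2))
        finally have "norm ((1 / l - 1) *\<^sub>R (y - z)) \<le> \<delta> * B"
          unfolding norm_scaleR using B(2)[of y] y KK1 \<delta> by (intro mult_mono) auto
        then show ?thesis using B by (simp add: \<delta>_def)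
      qed
      ultimately show ?thesis using sum1[OF y] by simp
    qed
    have i1: "integrable lborel (\<lambda>x. H1 x * \<phi> (T l x))" by (intro int1 cT)
    have "(LINT x|lborel. H1 x * \<phi> (T l x))
        = \<bar>1 / l\<bar> ^ DIM('a) *\<^sub>R
          (LINT y|lborel. H1 ((z - z /\<^sub>R l) + (1 / l) *\<^sub>R y) * \<phi> (T l ((z - z /\<^sub>R l) + (1 / l) *\<^sub>R y)))"
      using i1 l by (intro lborel_integral_affine) auto
    also have "\<dots> = (LINT y|lborel. H1 (z + (y - z) /\<^sub>R l) / l ^ DIM('a) * \<phi> y)"
    proof -
      have e1: "(z - z /\<^sub>R l) + (1 / l) *\<^sub>R y = z + (y - z) /\<^sub>R l" for y
        by (simp add: algebra_simps divide_inverse)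
      have e2: "T l (z + (y - z) /\<^sub>R l) = y" for y
        using l by (simp add: T_def)
      have e3: "\<bar>1 / l\<bar> ^ DIM('a) = 1 / l ^ DIM('a)" using l by (simp add: power_divide)
      show ?thesis
        unfolding e1 e2 e3 by simp
    qed
    also have "\<dots> \<ge> (LINT y|lborel. H1 y * \<phi> y)"
    proof (rule integral_mono)
      show "integrable lborel (\<lambda>y. H1 y * \<phi> y)" by (intro int1 continuous_on_subset[OF c\<phi>(1)]) auto
      have "integrable lborel (\<lambda>y. indicator K y *\<^sub>R (H (z + (y - z) /\<^sub>R l) / l ^ DIM('a) * \<phi> y))"
        by (intro borel_integrable_compact K(1) continuous_intros continuous_on_compose2[OF HK1]
            continuous_on_subset[OF c\<phi>(1)]) (use l near in auto)
      also have "(\<lambda>y. indicator K y *\<^sub>R (H (z + (y - z) /\<^sub>R l) / l ^ DIM('a) * \<phi> y))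
          = (\<lambda>y. H1 (z + (y - z) /\<^sub>R l) / l ^ DIM('a) * \<phi> y)"
        using K(3) near by (auto simp: H1_def indicator_def fun_eq_iff)
      finally show "integrable lborel (\<lambda>y. H1 (z + (y - z) /\<^sub>R l) / l ^ DIM('a) * \<phi> y)" .
      fix y
      show "H1 y * \<phi> y \<le> H1 (z + (y - z) /\<^sub>R l) / l ^ DIM('a) * \<phi> y"
      proof (cases "y \<in> K")
        case True
        then have "H y \<le> H (z + (y - z) /\<^sub>R l) / l ^ DIM('a)"
          using mono[OF l(1), of y] near K1A KK1 by blast
        then show ?thesis using True near[OF True] KK1 \<phi>(2)
          by (intro mult_right_mono) (auto simp: H1_def)
      qed (use K(3) in simp)
    qed
    finally show ?thesis
      using i1 int1[OF continuous_on_subset[OF c\<phi>(1)]]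
      by (simp add: right_diff_distrib)
  qed
  define l where "l = (\<lambda>n. 1 + \<delta> / real (Suc n))"
  have l: "l n > 1" "l n - 1 \<le> \<delta>" for n
    using \<delta> by (auto simp: l_def field_simps)
  have l1: "l \<longlonglongrightarrow> 1"
  proof -
    have "(\<lambda>n. \<delta> / real (Suc n)) \<longlonglongrightarrow> 0" by (rule LIMSEQ_Suc[OF lim_const_over_n])
    from tendsto_add[OF tendsto_const[of 1] this] show ?thesis unfolding l_def by simp
  qed
  define D where "D n x = H1 x * ((\<phi> (T (l n) x) - \<phi> x) / (l n - 1))" for n x
  have "(\<lambda>n. LINT x|lborel. D n x) \<longlonglongrightarrow> (LINT x|lborel. H1 x * ((x - z) \<bullet> grad \<phi> x))"
  proof (rule integral_dominated_convergence[where w = "\<lambda>x. \<bar>H1 x\<bar> * (C * B)"])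
    have "integrable lborel (\<lambda>x. H1 x * ((x - z) \<bullet> grad \<phi> x))"
      by (intro int1 continuous_intros continuous_on_subset[OF c\<phi>(2)]) auto
    then show "(\<lambda>x. H1 x * ((x - z) \<bullet> grad \<phi> x)) \<in> borel_measurable lborel" by simp
    show "D n \<in> borel_measurable lborel" for n
    proof -
      have "integrable lborel (D n)"
        unfolding D_def by (intro int1 continuous_intros cT continuous_on_subset[OF c\<phi>(1)])
          (use l(1)[of n] in auto)
      then show ?thesis by simp
    qed
    have "integrable lborel (\<lambda>x. \<bar>H1 x * 1\<bar>)"
      by (intro integrable_abs int1 continuous_intros)
    then show "integrable lborel (\<lambda>x. \<bar>H1 x\<bar> * (C * B))" by simp
    show "AE x in lborel. (\<lambda>n. D n x) \<longlonglongrightarrow> H1 x * ((x - z) \<bullet> grad \<phi> x)"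
    proof (rule AE_I2)
      fix x
      have d1: "((\<lambda>l. z + l *\<^sub>R (x - z)) has_derivative (\<lambda>h. h *\<^sub>R (x - z))) (at 1)"
        by (auto intro!: derivative_eq_intros)
      have d2: "(\<phi> has_derivative (\<lambda>h. h \<bullet> grad \<phi> x)) (at (z + 1 *\<^sub>R (x - z)))"
        using C1_onD[OF \<phi>(1), of x] by (simp add: gderiv_def)
      have "((\<lambda>l. \<phi> (T l x)) has_derivative (\<lambda>h. (h *\<^sub>R (x - z)) \<bullet> grad \<phi> x)) (at 1)"
        unfolding T_def by (rule has_derivative_compose[OF d1 d2])
      then have "((\<lambda>l. \<phi> (T l x)) has_real_derivative (x - z) \<bullet> grad \<phi> x) (at 1)"
        unfolding has_field_derivative_def
        by (rule has_derivative_eq_rhs) (auto simp: fun_eq_iff)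
      then have "((\<lambda>l. (\<phi> (T l x) - \<phi> (T 1 x)) / (l - 1)) \<longlongrightarrow> (x - z) \<bullet> grad \<phi> x) (at 1)"
        by (simp add: has_field_derivative_iff)
      moreover have "filterlim l (at 1) sequentially"
      proof -
        have "l n \<noteq> 1" for n using l(1)[of n] by simp
        then show ?thesis using l1 by (simp add: filterlim_at)
      qed
      ultimately have "(\<lambda>n. (\<phi> (T (l n) x) - \<phi> (T 1 x)) / (l n - 1)) \<longlonglongrightarrow> (x - z) \<bullet> grad \<phi> x"
        by (rule filterlim_compose)
      then show "(\<lambda>n. D n x) \<longlonglongrightarrow> H1 x * ((x - z) \<bullet> grad \<phi> x)"
        unfolding D_def by (intro tendsto_mult tendsto_const) (simp add: T_def)
    qed
    show "AE x in lborel. norm (D n x) \<le> \<bar>H1 x\<bar> * (C * B)" for n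
    proof (rule AE_I2)
      fix x
      show "norm (D n x) \<le> \<bar>H1 x\<bar> * (C * B)"
      proof (cases "x \<in> K1")
        case True
        have "T (l n) x - x = (l n - 1) *\<^sub>R (x - z)" by (simp add: T_def algebra_simps)
        then have "\<bar>\<phi> (T (l n) x) - \<phi> x\<bar> \<le> C * ((l n - 1) * norm (x - z))"
          using lip[of "T (l n) x" x] l(1)[of n] by simp
        also have "\<dots> \<le> C * ((l n - 1) * B)"
          using C l(1)[of n] B(2)[OF True] by (intro mult_left_mono) auto
        finally have "\<bar>(\<phi> (T (l n) x) - \<phi> x) / (l n - 1)\<bar> \<le> C * B"
          using l(1)[of n] by (simp add: field_simps)
        then show ?thesis unfolding D_def real_norm_def abs_mult by (rule mult_left_mono) simp
      qed (simp add: D_def H1_def)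
    qed
  qed
  moreover have "(LINT x|lborel. D n x) \<ge> 0" for n
  proof -
    have "(LINT x|lborel. D n x) = (LINT x|lborel. H1 x * (\<phi> (T (l n) x) - \<phi> x)) / (l n - 1)"
      by (simp add: D_def)
    then show ?thesis using key[OF l, of n] l(1)[of n] by simp
  qed
  ultimately have "(LINT x|lborel. H1 x * ((x - z) \<bullet> grad \<phi> x)) \<ge> 0"
    by (intro LIMSEQ_le_const) auto
  moreover have "(LINT x:A|lborel. H x * ((x - z) \<bullet> grad \<phi> x))
      = (LINT x:K1|lborel. H x * ((x - z) \<bullet> grad \<phi> x))"
  proof (rule set_integral_restrict[OF K1A])
    fix x assume "x \<in> A - K1"
    then have "x \<notin> K" using KK1 by blast
    then have "grad \<phi> x = 0"
      using grad_eq_0_off_support[of K \<phi> x] compact_imp_closed[OF K(1)] K(3) by blast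
    then show "H x * ((x - z) \<bullet> grad \<phi> x) = 0" by simp
  qed
  ultimately show ?thesis
    by (simp add: set_lebesgue_integral_def H1_def mult.assoc)
qed

section \<open>The comparison principle\<close>

lemma continuous_on_extend_by_zero:
  fixes h :: "'a::topological_space \<Rightarrow> 'b::real_normed_vector"
  assumes "open A" "closed K" "K \<subseteq> A" "continuous_on A h" "\<And>x. x \<in> A - K \<Longrightarrow> h x = 0"
  shows "continuous_on UNIV (\<lambda>x. if x \<in> A then h x else 0)"
proof -
  let ?g = "\<lambda>x. if x \<in> A then h x else 0"
  have "continuous_on A ?g" using assms(4) by (simp cong: continuous_on_cong)
  moreover have "continuous_on (- K) ?g"
  proof (rule continuous_on_eq[of _ "\<lambda>x. 0"])
    show "0 = ?g x" if "x \<in> - K" for x using assms(5) that by auto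
  qed simp
  ultimately have "continuous_on (A \<union> - K) ?g"
    using assms(1,2) by (intro continuous_on_open_Un) auto
  moreover have "A \<union> - K = UNIV" using assms(3) by blast
  ultimately show ?thesis by simp
qed

lemma DERIV_pos_part_square:
  "((\<lambda>s::real. (max s 0)\<^sup>2) has_real_derivative 2 * max s 0) (at s)"
proof -
  consider "s > 0" | "s < 0" | "s = 0" by linarith
  then show ?thesis
  proof cases
    case 1
    have "((\<lambda>s::real. s\<^sup>2) has_real_derivative 2 * max s 0) (at s)"
      using 1 by (auto intro!: derivative_eq_intros)
    then show ?thesis
      by (rule has_field_derivative_transform_within_open[of _ _ _ "{0<..}"]) (use 1 in auto)
  next
    case 2
    have "((\<lambda>s::real. 0) has_real_derivative 2 * max s 0) (at s)" using 2 by simp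
    then show ?thesis
      by (rule has_field_derivative_transform_within_open[of _ _ _ "{..<0}"]) (use 2 in auto)
  next
    case 3
    have "((\<lambda>h::real. max h 0) \<longlongrightarrow> max 0 0) (at 0)" by (intro tendsto_intros)
    then have "((\<lambda>h::real. max h 0) \<longlongrightarrow> 0) (at 0)" by simp
    then have "((\<lambda>h::real. ((max (0 + h) 0)\<^sup>2 - (max 0 0)\<^sup>2) / h) \<longlongrightarrow> 0) (at 0)"
    proof (rule Lim_transform_eventually)
      show "\<forall>\<^sub>F h in at 0. max h 0 = ((max (0 + h) 0)\<^sup>2 - (max 0 0)\<^sup>2) / (h::real)"
        by (rule always_eventually) (auto simp: max_def power2_eq_square)
    qed
    then show ?thesis unfolding 3 DERIV_def by simp
  qed
qed

text \<open>Weak comparison between a subsolution \<open>v\<close> and a supersolution \<open>u\<close>.  The boundary inequality \<open>v \<le> u\<close> is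
encoded as the compactness in \<open>A\<close> of the sets where \<open>v - u \<ge> \<delta>\<close>, so that nothing has to be said about
values on the boundary and the C1 function \<open>(max (v - u - \<delta>) 0)\<^sup>2\<close> is an admissible test function.\<close>

lemma plap_comparison:
  fixes u v :: "'a::euclidean_space \<Rightarrow> real"
  assumes A: "open A" "bounded A"
    and p: "continuous_on A p" "\<And>x. x \<in> A \<Longrightarrow> p x > 1"
    and u: "C1_on A u" and v: "C1_on A v"
    and sub: "\<And>\<phi> K. C1_on UNIV \<phi> \<Longrightarrow> (\<And>x. \<phi> x \<ge> 0) \<Longrightarrow> compact K \<Longrightarrow> K \<subseteq> A \<Longrightarrow>
      (\<And>x. x \<notin> K \<Longrightarrow> \<phi> x = 0) \<Longrightarrow> (LINT x:A|lborel. plap_field (p x) (grad v x) \<bullet> grad \<phi> x) \<le> 0"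
    and super: "\<And>\<phi> K. C1_on UNIV \<phi> \<Longrightarrow> (\<And>x. \<phi> x \<ge> 0) \<Longrightarrow> compact K \<Longrightarrow> K \<subseteq> A \<Longrightarrow>
      (\<And>x. x \<notin> K \<Longrightarrow> \<phi> x = 0) \<Longrightarrow> (LINT x:A|lborel. plap_field (p x) (grad u x) \<bullet> grad \<phi> x) \<ge> 0"
    and bdry: "\<And>\<delta>. \<delta> > 0 \<Longrightarrow> compact {x \<in> A. v x - u x \<ge> \<delta>}"
    and x: "x \<in> A"
  shows "v x \<le> u x"
proof -
  have "v x \<le> u x + \<delta>" if \<delta>: "\<delta> > 0" for \<delta>
  proof -
    define K where "K = {x \<in> A. v x - u x \<ge> \<delta>}"
    have K: "compact K" "closed K" "K \<subseteq> A"
      using bdry[OF \<delta>] compact_imp_closed by (auto simp: K_def)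
    define \<phi> where "\<phi> x = (if x \<in> A then (max (v x - u x - \<delta>) 0)\<^sup>2 else 0)" for x
    define D where "D x = (2 * max (v x - u x - \<delta>) 0) *\<^sub>R (grad v x - grad u x)" for x
    define D0 where "D0 x = (if x \<in> A then D x else 0)" for x
    have \<phi>0: "\<phi> x \<ge> 0" for x by (simp add: \<phi>_def)
    have \<phi>K: "\<phi> x = 0" if "x \<notin> K" for x using that by (auto simp: \<phi>_def K_def)
    have DK: "D x = 0" if "x \<in> A - K" for x using that by (auto simp: D_def K_def)
    have der: "GDERIV \<phi> x :> D0 x" for x
    proof (cases "x \<in> A")
      case True
      have "GDERIV (\<lambda>x. v x - u x - \<delta>) x :> grad v x - grad u x - 0"
        by (intro GDERIV_diff GDERIV_const C1_onD[OF u True] C1_onD[OF v True])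
      from GDERIV_DERIV_compose[OF this DERIV_pos_part_square]
      have "GDERIV (\<lambda>x. (max (v x - u x - \<delta>) 0)\<^sup>2) x :> D x" by (simp add: D_def)
      then have "(\<phi> has_derivative (\<lambda>h. h \<bullet> D x)) (at x)"
        unfolding gderiv_def
        by (rule has_derivative_transform_within_open[of _ _ _ _ A]) (use A True in \<open>auto simp: \<phi>_def\<close>)
      then show ?thesis using True by (simp add: gderiv_def D0_def)
    next
      case False
      have "((\<lambda>x. 0) has_derivative (\<lambda>h. h \<bullet> 0)) (at x)" by simp
      then have "(\<phi> has_derivative (\<lambda>h. h \<bullet> 0)) (at x)"
        by (rule has_derivative_transform_within_open[of _ _ _ _ "- K"]) (use K False \<phi>K in auto)
      then show ?thesis using False by (simp add: gderiv_def D0_def)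
    qed
    have grad\<phi>: "grad \<phi> = D0" using grad_eq[OF der] by auto
    have cu: "continuous_on A u" "continuous_on A (grad u)" and cv: "continuous_on A v" "continuous_on A (grad v)"
      using u v C1_on_cont C1_on_cont_grad by auto
    have cD: "continuous_on A D" unfolding D_def by (intro continuous_intros cu cv)
    have cD0: "continuous_on UNIV D0"
      unfolding D0_def by (rule continuous_on_extend_by_zero[OF A(1) K(2,3) cD DK])
    have \<phi>C1: "C1_on UNIV \<phi>" unfolding C1_on_def grad\<phi> using der cD0 by blast
    define Fu Fv where "Fu x = plap_field (p x) (grad u x)" and "Fv x = plap_field (p x) (grad v x)" for x
    have cF: "continuous_on A Fu" "continuous_on A Fv"
      unfolding Fu_def Fv_def by (intro continuous_on_plap_field p cu cv; assumption)+
    have ext: "continuous_on UNIV (\<lambda>x. if x \<in> A then F x \<bullet> D x else 0)"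
        "set_integrable lborel A (\<lambda>x. F x \<bullet> grad \<phi> x)"
      if "continuous_on A F" for F :: "'a \<Rightarrow> 'a"
    proof -
      show 1: "continuous_on UNIV (\<lambda>x. if x \<in> A then F x \<bullet> D x else 0)"
        by (rule continuous_on_extend_by_zero[OF A(1) K(2,3)])
          (auto intro!: continuous_intros that cD simp: DK)
      have "integrable lborel (\<lambda>x. if x \<in> A then F x \<bullet> D x else 0)"
        by (rule integrable_continuous_compact_support[OF 1 K(1)]) (use DK in auto)
      also have "(\<lambda>x. if x \<in> A then F x \<bullet> D x else 0) = (\<lambda>x. indicator A x *\<^sub>R (F x \<bullet> grad \<phi> x))"
        by (auto simp: grad\<phi> D0_def indicator_def)
      finally show "set_integrable lborel A (\<lambda>x. F x \<bullet> grad \<phi> x)" unfolding set_integrable_def .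
    qed
    define f where "f x = (if x \<in> A then (Fv x - Fu x) \<bullet> D x else 0)" for x
    have f_eq: "f x = 2 * max (v x - u x - \<delta>) 0 * ((Fv x - Fu x) \<bullet> (grad v x - grad u x))" if "x \<in> A" for x
      using that by (simp add: f_def D_def)
    \<comment> \<open>The two weak inequalities bound the integral of \<open>f\<close> by 0, but \<open>f\<close> is nonnegative by the
      monotonicity of \<open>plap_field\<close>.\<close>
    have f0: "f x = 0" for x
    proof (rule integral_zero_imp_zero[OF _ K(1)])
      show "continuous_on UNIV f" unfolding f_def by (intro ext continuous_intros cF)
      show "f x = 0" if "x \<notin> K" for x using that DK by (auto simp: f_def)
      show "f x \<ge> 0" for x
      proof (cases "x \<in> A")
        case True
        then show ?thesis unfolding f_eq[OF True]
          using plap_field_strict_mono(1)[OF p(2)[OF True], of "grad v x" "grad u x"]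
          by (simp add: Fu_def Fv_def)
      qed (simp add: f_def)
      have "(LINT x|lborel. f x) = (LINT x:A|lborel. Fv x \<bullet> grad \<phi> x - Fu x \<bullet> grad \<phi> x)"
        unfolding set_lebesgue_integral_def
        by (rule Bochner_Integration.integral_cong)
          (auto simp: f_def grad\<phi> D0_def indicator_def inner_diff_left)
      also have "\<dots> = (LINT x:A|lborel. Fv x \<bullet> grad \<phi> x) - (LINT x:A|lborel. Fu x \<bullet> grad \<phi> x)"
        by (rule set_integral_diff(2)[OF ext(2)[OF cF(2)] ext(2)[OF cF(1)]])
      also have "\<dots> \<le> 0"
        using sub[OF \<phi>C1 \<phi>0 K(1,3) \<phi>K] super[OF \<phi>C1 \<phi>0 K(1,3) \<phi>K] by (simp add: Fu_def Fv_def)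
      finally show "(LINT x|lborel. f x) \<le> 0" .
    qed
    have "D0 x = 0" for x
    proof (cases "x \<in> A")
      case True
      then have "max (v x - u x - \<delta>) 0 = 0 \<or> grad v x = grad u x"
        using f0[of x] plap_field_strict_mono(2)[OF p(2)[OF True], of "grad v x" "grad u x"]
        unfolding f_eq[OF True] Fu_def Fv_def by auto
      then show ?thesis by (auto simp: D0_def D_def)
    qed (simp add: D0_def)
    then have "\<exists>c. \<forall>x\<in>UNIV. \<phi> x = c"
      using der by (intro has_derivative_zero_constant) (auto simp: gderiv_def)
    then obtain c where c: "\<And>x. \<phi> x = c" by blast
    \<comment> \<open>The gradient of \<open>\<phi>\<close> vanishes identically and \<open>\<phi>\<close> has bounded support.\<close>
    have "K \<noteq> UNIV" using K(1) compact_imp_bounded not_bounded_UNIV by metis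
    then obtain w where "w \<notin> K" by blast
    then have "c = 0" using \<phi>K[of w] c[of w] by simp
    then show ?thesis using c[of x] x by (auto simp: \<phi>_def)
  qed
  then show ?thesis by (rule field_le_epsilon)
qed

section \<open>The barrier\<close>

text \<open>The radial function \<open>m / \<mu> * (exp (- \<mu> * (s - r)) - exp (- \<mu> * (R - r)))\<close>, \<open>s = norm (x - z)\<close>, on the
annulus \<open>r < s < R\<close>.  It vanishes for \<open>s = R\<close>, it is at most \<open>m\<close> for \<open>s = r\<close> if \<open>\<mu> \<ge> 1\<close>, and its slope has
absolute value \<open>m * exp (- \<mu> * (s - r))\<close>, so that the logarithm of the slope is at most
\<open>\<bar>ln m\<bar> + \<mu> * (R - r)\<close> in absolute value.\<close>

definition barrier :: "'a::euclidean_space \<Rightarrow> real \<Rightarrow> real \<Rightarrow> real \<Rightarrow> real \<Rightarrow> 'a \<Rightarrow> real" where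
  "barrier z r R m \<mu> x = m / \<mu> * (exp (- \<mu> * (norm (x - z) - r)) - exp (- \<mu> * (R - r)))"

lemma GDERIV_barrier:
  assumes "x \<noteq> z" "\<mu> \<noteq> 0"
  shows "GDERIV (barrier z r R m \<mu>) x :> - (m * exp (- \<mu> * (norm (x - z) - r))) *\<^sub>R sgn (x - z)"
proof -
  have "GDERIV norm (x - z) :> sgn (x - z)" using GDERIV_norm[of "x - z"] assms by simp
  then have "((\<lambda>x. norm (x - z)) has_derivative (\<lambda>h. h \<bullet> sgn (x - z))) (at x)"
    unfolding gderiv_def
    by (rule has_derivative_compose[rotated, where f = "\<lambda>x. x - z", simplified])
      (auto intro!: derivative_eq_intros)
  then have "GDERIV (\<lambda>x. norm (x - z)) x :> sgn (x - z)" by (simp add: gderiv_def)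
  moreover have "((\<lambda>s. m / \<mu> * (exp (- \<mu> * (s - r)) - exp (- \<mu> * (R - r)))) has_real_derivative
      - (m * exp (- \<mu> * (norm (x - z) - r)))) (at (norm (x - z)))"
    using assms(2) by (auto intro!: derivative_eq_intros)
  ultimately show ?thesis
    unfolding barrier_def by (rule GDERIV_DERIV_compose)
qed

lemma C1_on_barrier:
  assumes "z \<notin> A" "\<mu> \<noteq> 0"
  shows "C1_on A (barrier z r R m \<mu>)"
  unfolding C1_on_def
proof
  have ne: "x \<noteq> z" if "x \<in> A" for x using that assms(1) by blast
  show "\<forall>x\<in>A. \<exists>D. GDERIV (barrier z r R m \<mu>) x :> D" using GDERIV_barrier[OF ne assms(2)] by blast
  have "continuous_on A (\<lambda>x. - (m * exp (- \<mu> * (norm (x - z) - r))) *\<^sub>R sgn (x - z))"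
    by (intro continuous_intros) (use ne in auto)
  then show "continuous_on A (grad (barrier z r R m \<mu>))"
    by (rule continuous_on_eq) (simp add: grad_eq[OF GDERIV_barrier[OF ne assms(2)]])
qed

text \<open>The hypothesis of \<open>radial_field_dilation\<close> for the flux of the barrier.  Put \<open>s = norm (x - z)\<close> and
\<open>t = s / l < s\<close>, and let \<open>a\<close> be the logarithm of the slope.  In logarithms the claim is
\<open>(N - 1) * ln l \<le> (p y - 1) * a t - (p x - 1) * a s\<close>, with \<open>y\<close> the dilated point and \<open>N\<close> the dimension.
The right-hand side is \<open>(p x - 1) * (a t - a s) + (p y - p x) * a t\<close>, where the first summand is at least
\<open>(p1 - 1) * \<mu> * (s - t)\<close> and the second one is controlled by the Lipschitz constant of \<open>p\<close>; the
hypothesis \<open>large\<close> makes the first one win.\<close>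

lemma barrier_flux_dilation:
  fixes z :: "'a::euclidean_space"
  assumes "0 < r" and p: "L-lipschitz_on A p" "\<And>x. x \<in> A \<Longrightarrow> p1 \<le> p x" "1 < p1"
    and A: "A = {x. r < norm (x - z) \<and> norm (x - z) < R}"
    and m: "0 < m" and \<mu>: "0 < \<mu>"
    and large: "L * (\<bar>ln m\<bar> + \<mu> * (R - r)) + (DIM('a) - 1) / r \<le> (p1 - 1) * \<mu>"
    and l: "1 < l" and x: "x \<in> A" and x': "z + (x - z) /\<^sub>R l \<in> A"
  defines "H \<equiv> \<lambda>x. (m * exp (- \<mu> * (norm (x - z) - r))) powr (p x - 1) / norm (x - z)"
  shows "H x \<le> H (z + (x - z) /\<^sub>R l) / l ^ DIM('a)"
proof -
  define y where "y = z + (x - z) /\<^sub>R l"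
  define s t where "s = norm (x - z)" and "t = norm (y - z)"
  define a where "a s = ln m - \<mu> * (s - r)" for s
  have st: "s = l * t" using l by (simp add: s_def t_def y_def)
  have t: "r < t" "t < R" using x' by (auto simp: A y_def t_def)
  have s: "r < s" "s < R" using x by (auto simp: A s_def)
  have pos: "0 < t" "0 < s" using t s assms(1) by auto
  have "t < s" using st l pos by simp
  have H: "H w = exp ((p w - 1) * a (norm (w - z)) - ln (norm (w - z)))" if "w \<in> A" for w
  proof -
    have "norm (w - z) > 0" using that assms(1) by (auto simp: A)
    moreover have "ln (m * exp (- \<mu> * (norm (w - z) - r))) = a (norm (w - z))"
      using m by (simp add: ln_mult a_def)
    ultimately show ?thesis
      using m by (simp add: H_def powr_def exp_diff)
  qed
  have ll: "l ^ DIM('a) = exp (DIM('a) * ln l)" using l by (simp add: exp_of_nat_mult)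
  have lnl: "ln s = ln l + ln t" using st l pos by (simp add: ln_mult)
  have dist: "norm (y - x) = s - t"
  proof -
    have "y - x = - ((1 - 1 / l) *\<^sub>R (x - z))" by (simp add: y_def algebra_simps divide_inverse)
    then have "norm (y - x) = (1 - 1 / l) * s" using l by (simp add: s_def)
    also have "\<dots> = s - t" using st l by (simp add: field_simps)
    finally show ?thesis .
  qed
  have plip: "\<bar>p y - p x\<bar> \<le> L * (s - t)"
    using lipschitz_onD[OF p(1) x'[folded y_def] x] by (simp add: dist_norm dist)
  have at: "\<bar>a t\<bar> \<le> \<bar>ln m\<bar> + \<mu> * (R - r)"
  proof -
    have "\<mu> * (t - r) \<le> \<mu> * (R - r)" "0 \<le> \<mu> * (t - r)" using t \<mu> by auto
    then show ?thesis unfolding a_def by linarith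
  qed
  have L: "0 \<le> L" using p(1) lipschitz_on_nonneg by blast
  have 1: "(p x - 1) * (a t - a s) \<ge> (p1 - 1) * \<mu> * (s - t)"
  proof -
    have "a t - a s = \<mu> * (s - t)" by (simp add: a_def algebra_simps)
    then show ?thesis using p(2)[OF x] \<mu> \<open>t < s\<close> by (simp add: mult.assoc mult_right_mono)
  qed
  have 2: "\<bar>(p y - p x) * a t\<bar> \<le> L * (\<bar>ln m\<bar> + \<mu> * (R - r)) * (s - t)"
  proof -
    have "\<bar>(p y - p x) * a t\<bar> \<le> (L * (s - t)) * (\<bar>ln m\<bar> + \<mu> * (R - r))"
      unfolding abs_mult using plip at L \<open>t < s\<close> by (intro mult_mono) auto
    then show ?thesis by (simp add: mult_ac)
  qed
  have 3: "(DIM('a) - 1) * ln l \<le> (DIM('a) - 1) / r * (s - t)"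
  proof -
    have "ln l \<le> l - 1" using l by (intro ln_le_minus_one) simp
    also have "\<dots> = (s - t) / t" using st pos by (simp add: field_simps)
    also have "\<dots> \<le> (s - t) / r" using t assms(1) \<open>t < s\<close> by (intro divide_left_mono) auto
    finally have "real (DIM('a) - 1) * ln l \<le> real (DIM('a) - 1) * ((s - t) / r)"
      by (rule mult_left_mono) simp
    then show ?thesis by simp
  qed
  have 4: "L * (\<bar>ln m\<bar> + \<mu> * (R - r)) * (s - t) + (DIM('a) - 1) / r * (s - t) \<le> (p1 - 1) * \<mu> * (s - t)"
    using mult_right_mono[OF large, of "s - t"] \<open>t < s\<close> by (simp add: distrib_right)
  have dim: "real (DIM('a) - 1) = real DIM('a) - 1" by (simp add: of_nat_diff Suc_leI)
  have "(p x - 1) * a s - ln s \<le> (p y - 1) * a t - ln t - DIM('a) * ln l"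
  proof -
    have "(p y - 1) * a t - (p x - 1) * a s = (p x - 1) * (a t - a s) + (p y - p x) * a t"
      by (simp add: algebra_simps)
    then have "(p y - 1) * a t - (p x - 1) * a s \<ge> real (DIM('a) - 1) * ln l"
      using 1 2 3 4 by linarith
    then show ?thesis using lnl unfolding dim by (simp add: algebra_simps)
  qed
  then show ?thesis
    unfolding H[OF x] H[OF x'] ll
    by (simp add: s_def t_def y_def flip: exp_diff)
qed

lemma barrier_subsolution:
  fixes z :: "'a::euclidean_space"
  assumes r: "0 < r" and p: "L-lipschitz_on A p" "\<And>x. x \<in> A \<Longrightarrow> p1 \<le> p x" "1 < p1"
    and A: "A = {x. r < norm (x - z) \<and> norm (x - z) < R}"
    and m: "0 < m" and \<mu>: "0 < \<mu>"
    and large: "L * (\<bar>ln m\<bar> + \<mu> * (R - r)) + (DIM('a) - 1) / r \<le> (p1 - 1) * \<mu>"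
    and \<phi>: "C1_on UNIV \<phi>" "\<And>x. \<phi> x \<ge> 0"
    and K: "compact K" "K \<subseteq> A" "\<And>x. x \<notin> K \<Longrightarrow> \<phi> x = 0"
  shows "(LINT x:A|lborel. plap_field (p x) (grad (barrier z r R m \<mu>) x) \<bullet> grad \<phi> x) \<le> 0"
proof -
  define H where "H x = (m * exp (- \<mu> * (norm (x - z) - r))) powr (p x - 1) / norm (x - z)" for x
  have ne: "x \<noteq> z" if "x \<in> A" for x using that r by (auto simp: A)
  have openA: "open A" unfolding A by (intro open_Collect_conj open_Collect_less continuous_intros)
  have cH: "continuous_on A H"
    unfolding H_def
    by (intro continuous_intros continuous_on_powr lipschitz_on_continuous_on[OF p(1)]) (use ne m in auto)
  have "(LINT x:A|lborel. H x * ((x - z) \<bullet> grad \<phi> x)) \<ge> 0"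
  proof (rule radial_field_dilation[OF openA cH _ \<phi> K])
    show "H x \<le> H (z + (x - z) /\<^sub>R l) / l ^ DIM('a)"
      if "l > 1" "x \<in> A" "z + (x - z) /\<^sub>R l \<in> A" for l x
      unfolding H_def by (rule barrier_flux_dilation[OF r p A m \<mu> large that])
  qed
  moreover have "(LINT x:A|lborel. plap_field (p x) (grad (barrier z r R m \<mu>) x) \<bullet> grad \<phi> x)
      = (LINT x:A|lborel. - (H x * ((x - z) \<bullet> grad \<phi> x)))"
    unfolding set_lebesgue_integral_def
  proof (rule Bochner_Integration.integral_cong)
    fix x
    have "plap_field (p x) (grad (barrier z r R m \<mu>) x) = - (H x *\<^sub>R (x - z))" if x: "x \<in> A"
    proof -
      define g where "g = m * exp (- \<mu> * (norm (x - z) - r))"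
      have g: "g > 0" using m by (simp add: g_def)
      have "grad (barrier z r R m \<mu>) x = - g *\<^sub>R sgn (x - z)"
        unfolding g_def using \<mu> by (intro grad_eq GDERIV_barrier ne x) simp
      then have "plap_field (p x) (grad (barrier z r R m \<mu>) x) = - ((g powr (p x - 2) * g) *\<^sub>R sgn (x - z))"
        using g ne[OF x] by (simp add: plap_field_def norm_sgn)
      also have "g powr (p x - 2) * g = g powr (p x - 1)"
        using powr_add[of g "p x - 2" 1] g by simp
      finally show ?thesis by (simp add: H_def g_def sgn_div_norm divide_inverse)
    qed
    then show "indicator A x *\<^sub>R (plap_field (p x) (grad (barrier z r R m \<mu>) x) \<bullet> grad \<phi> x)
        = indicator A x *\<^sub>R - (H x * ((x - z) \<bullet> grad \<phi> x))"
      by (simp add: indicator_def)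
  qed simp
  ultimately show ?thesis by (simp add: set_lebesgue_integral_def)
qed

section \<open>Growth near the boundary of the ball\<close>

text \<open>The width \<open>d\<close> of the annulus is chosen first, so that \<open>L * d \<le> (p1 - 1) / 2\<close>; then \<open>m\<close> is the minimum of \<open>u\<close>
on the inner sphere, and \<open>\<mu>\<close> is taken large last.\<close>

lemma hopf_lower_bound:
  fixes \<Omega> :: "'a::euclidean_space set"
  assumes \<Omega>: "open \<Omega>" and p1: "1 < p1" and p: "\<forall>x\<in>\<Omega>. p1 \<le> p x" "L-lipschitz_on \<Omega> p"
    and u: "C1_on \<Omega> u" "px_laplacian_nonpos \<Omega> p u"
    and R: "0 < R" "ball z R \<subseteq> \<Omega>"
    and ub: "continuous_on (cball z R) u" "\<forall>x\<in>ball z R. 0 < u x"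
  shows "\<exists>c>0. \<exists>d>0. d < R \<and>
    (\<forall>x. R - d < norm (x - z) \<and> norm (x - z) < R \<longrightarrow> c * (R - norm (x - z)) \<le> u x)"
proof -
  have L: "0 \<le> L" using p(2) lipschitz_on_nonneg by blast
  define d where "d = min (R / 2) ((p1 - 1) / (2 * (L + 1)))"
  have d: "0 < d" "d \<le> R / 2"
    using R p1 L unfolding d_def by (simp, intro min.cobounded1)
  then have "d < R" using R by simp
  have Ld: "L * d \<le> (p1 - 1) / 2"
  proof -
    have "d * (2 * (L + 1)) \<le> p1 - 1"
    proof -
      have "d \<le> (p1 - 1) / (2 * (L + 1))" unfolding d_def by (rule min.cobounded2)
      then show ?thesis using L by (simp add: pos_le_divide_eq del: distrib_left_numeral)
    qed
    then show ?thesis using d by (simp add: algebra_simps)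
  qed
  define r where "r = R - d"
  have r: "0 < r" "r < R" "R - r = d" using d \<open>d < R\<close> by (auto simp: r_def)
  have u0: "0 \<le> u x" if "x \<in> cball z R" for x
  proof (rule continuous_ge_on_closure[of "ball z R" u x])
    show "continuous_on (closure (ball z R)) u" "x \<in> closure (ball z R)" using ub(1) that R by auto
    show "u x \<ge> 0" if "x \<in> ball z R" for x using ub(2) that by (simp add: less_imp_le)
  qed
  obtain m where m: "0 < m" "\<And>x. norm (x - z) = r \<Longrightarrow> m \<le> u x"
  proof -
    have "sphere z r \<subseteq> ball z R" using r by auto
    then have "continuous_on (sphere z r) u" using ub(1) ball_subset_cball continuous_on_subset by blast
    moreover have "sphere z r \<noteq> {}" using r by simp
    ultimately obtain x0 where "x0 \<in> sphere z r" "\<And>x. x \<in> sphere z r \<Longrightarrow> u x0 \<le> u x"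
      using continuous_attains_inf[OF compact_sphere, of z r u] by blast
    moreover have "0 < u x0" using calculation(1) \<open>sphere z r \<subseteq> ball z R\<close> ub(2) by blast
    ultimately show ?thesis using that[of "u x0"] by (simp add: dist_norm norm_minus_commute)
  qed
  define M where "M = L * \<bar>ln m\<bar> + (DIM('a) - 1) / r"
  define \<mu> where "\<mu> = max 1 (2 * M / (p1 - 1))"
  have \<mu>: "0 < \<mu>" "1 \<le> \<mu>" by (auto simp: \<mu>_def)
  have large: "L * (\<bar>ln m\<bar> + \<mu> * (R - r)) + (DIM('a) - 1) / r \<le> (p1 - 1) * \<mu>"
  proof -
    have "2 * M / (p1 - 1) \<le> \<mu>" by (simp add: \<mu>_def)
    then have "M \<le> (p1 - 1) / 2 * \<mu>" using p1 by (simp add: field_simps)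
    moreover have "L * d * \<mu> \<le> (p1 - 1) / 2 * \<mu>" using Ld \<mu> by (intro mult_right_mono) auto
    ultimately have "M + L * d * \<mu> \<le> (p1 - 1) * \<mu>" by (simp add: field_simps)
    moreover have "L * (\<bar>ln m\<bar> + \<mu> * (R - r)) + (DIM('a) - 1) / r = M + L * d * \<mu>"
      unfolding r(3) M_def by (simp add: distrib_left mult_ac)
    ultimately show ?thesis by simp
  qed
  define A where "A = {x. r < norm (x - z) \<and> norm (x - z) < R}"
  have openA: "open A" unfolding A_def by (intro open_Collect_conj open_Collect_less continuous_intros)
  have Aball: "A \<subseteq> ball z R" by (auto simp: A_def dist_norm norm_minus_commute)
  then have A\<Omega>: "A \<subseteq> \<Omega>" using R(2) by blast
  have bddA: "bounded A" using Aball bounded_ball bounded_subset by blast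
  have zA: "z \<notin> A" using r by (simp add: A_def)
  have pA: "L-lipschitz_on A p" "\<And>x. x \<in> A \<Longrightarrow> p1 \<le> p x"
    using p A\<Omega> lipschitz_on_subset by blast+
  have p\<Omega>: "continuous_on \<Omega> p" "\<And>x. x \<in> \<Omega> \<Longrightarrow> 1 < p x"
    using p p1 lipschitz_on_continuous_on by (blast, force)
  have uA: "C1_on A u" using u(1) A\<Omega> continuous_on_subset unfolding C1_on_def by blast
  define w where "w = barrier z r R m \<mu>"
  have wA: "C1_on A w" unfolding w_def using zA \<mu> by (intro C1_on_barrier) auto
  have wu: "w x \<le> u x" if "x \<in> A" for x
  proof (rule plap_comparison[OF openA bddA _ _ uA wA _ _ _ that])
    show "continuous_on A p" using p\<Omega>(1) A\<Omega> continuous_on_subset by blast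
    show "1 < p x" if "x \<in> A" for x using p\<Omega>(2) A\<Omega> that by blast
  next
    fix \<phi> K
    assume \<phi>: "C1_on UNIV \<phi>" "\<And>x. \<phi> x \<ge> 0" and K: "compact K" "K \<subseteq> A" "\<And>x. x \<notin> K \<Longrightarrow> \<phi> x = 0"
    show "(LINT x:A|lborel. plap_field (p x) (grad w x) \<bullet> grad \<phi> x) \<le> 0"
      unfolding w_def by (rule barrier_subsolution[OF r(1) pA p1 A_def m(1) \<mu>(1) large \<phi> K])
    have "(LINT x:\<Omega>|lborel. plap_field (p x) (grad u x) \<bullet> grad \<phi> x) \<ge> 0"
    proof (rule weak_ineq_C1_test[OF \<Omega> _ _ \<phi> K(1) _ K(3)])
      show "continuous_on \<Omega> (\<lambda>x. plap_field (p x) (grad u x))"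
        by (rule continuous_on_plap_field[OF p\<Omega> C1_on_cont_grad[OF u(1)]])
      show "(LINT x:\<Omega>|lborel. plap_field (p x) (grad u x) \<bullet> grad \<psi> x) \<ge> 0"
        if "test_function \<Omega> \<psi>" "\<And>x. \<psi> x \<ge> 0" for \<psi>
        using u(2) that unfolding px_laplacian_nonpos_def by blast
      show "K \<subseteq> \<Omega>" using K A\<Omega> by blast
    qed
    also have "(LINT x:\<Omega>|lborel. plap_field (p x) (grad u x) \<bullet> grad \<phi> x)
        = (LINT x:A|lborel. plap_field (p x) (grad u x) \<bullet> grad \<phi> x)"
    proof (rule set_integral_restrict[OF A\<Omega>])
      fix x assume "x \<in> \<Omega> - A"
      then have "grad \<phi> x = 0"
        using grad_eq_0_off_support[of K \<phi> x] compact_imp_closed[OF K(1)] K(2,3) by blast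
      then show "plap_field (p x) (grad u x) \<bullet> grad \<phi> x = 0" by simp
    qed
    finally show "(LINT x:A|lborel. plap_field (p x) (grad u x) \<bullet> grad \<phi> x) \<ge> 0" .
  next
    fix \<delta> :: real assume \<delta>: "\<delta> > 0"
    define C where "C = cball z R - ball z r"
    have C: "compact C" unfolding C_def by (intro compact_diff compact_cball open_ball)
    have inC: "x \<in> C \<longleftrightarrow> r \<le> norm (x - z) \<and> norm (x - z) \<le> R" for x
      by (auto simp: C_def dist_norm norm_minus_commute)
    \<comment> \<open>On the two bounding spheres the barrier does not exceed \<open>u\<close>.\<close>
    have "x \<in> A" if x: "x \<in> C" "\<delta> \<le> w x - u x" for x
    proof -
      have "norm (x - z) \<noteq> r"
      proof
        assume nr: "norm (x - z) = r"
        then have "w x = m / \<mu> * (1 - exp (- \<mu> * (R - r)))" by (simp add: w_def barrier_def)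
        also have "\<dots> \<le> m / \<mu> * 1" using m \<mu> by (intro mult_left_mono) auto
        also have "\<dots> \<le> m" using m \<mu> by (simp add: divide_le_eq)
        also have "\<dots> \<le> u x" using m(2) nr by blast
        finally show False using x \<delta> by simp
      qed
      moreover have "norm (x - z) \<noteq> R"
      proof
        assume "norm (x - z) = R"
        then have "w x = 0" "0 \<le> u x"
          using u0[of x] by (auto simp: w_def barrier_def dist_norm norm_minus_commute)
        then show False using x \<delta> by simp
      qed
      ultimately show ?thesis using x inC[of x] by (auto simp: A_def)
    qed
    moreover have "A \<subseteq> C" by (auto simp: A_def inC)
    ultimately have "{x \<in> A. \<delta> \<le> w x - u x} = {x \<in> C. \<delta> \<le> w x - u x}" by blast
    moreover have "compact {x \<in> C. \<delta> \<le> w x - u x}"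
    proof -
      have "continuous_on C u" using ub(1) unfolding C_def by (rule continuous_on_subset) auto
      then have "closed {x \<in> C. \<delta> \<le> w x - u x}"
        unfolding w_def barrier_def
        by (intro continuous_on_closed_Collect_le continuous_intros compact_imp_closed[OF C])
      then have "compact (C \<inter> {x \<in> C. \<delta> \<le> w x - u x})" by (rule compact_Int_closed[OF C])
      moreover have "C \<inter> {x \<in> C. \<delta> \<le> w x - u x} = {x \<in> C. \<delta> \<le> w x - u x}" by blast
      ultimately show ?thesis by simp
    qed
    ultimately show "compact {x \<in> A. \<delta> \<le> w x - u x}" by simp
  qed
  show ?thesis
  proof (intro exI conjI allI impI)
    show "0 < m * exp (- \<mu> * d)" using m by simp
    show "0 < d" "d < R" using d \<open>d < R\<close> by auto
    fix x assume x: "R - d < norm (x - z) \<and> norm (x - z) < R"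
    define s where "s = norm (x - z)"
    \<comment> \<open>By convexity the barrier lies above its tangent line at the outer sphere.\<close>
    have "exp (- \<mu> * d) * (\<mu> * (R - s)) \<le> exp (- \<mu> * d) * (exp (\<mu> * (R - s)) - 1)"
      using exp_ge_add_one_self[of "\<mu> * (R - s)"] by (intro mult_left_mono) (linarith, simp)
    also have "\<dots> = exp (- \<mu> * (s - r)) - exp (- \<mu> * (R - r))"
      using r(3) by (simp add: algebra_simps flip: exp_add)
    finally have "m / \<mu> * (exp (- \<mu> * d) * (\<mu> * (R - s))) \<le> w x"
      unfolding w_def barrier_def s_def using m \<mu> by (intro mult_left_mono) auto
    moreover have "m / \<mu> * (exp (- \<mu> * d) * (\<mu> * (R - s))) = m * exp (- \<mu> * d) * (R - s)"
      using \<mu> by simp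
    moreover have "x \<in> A" using x by (simp add: A_def r_def)
    ultimately show "m * exp (- \<mu> * d) * (R - norm (x - z)) \<le> u x"
      using wu[of x] unfolding s_def by linarith
  qed
qed

text \<open>A point of the smaller ball that touches \<open>sphere z R\<close> at \<open>y\<close> from inside has a distance from that sphere
comparable with its distance from the tangent hyperplane at \<open>y\<close>.\<close>

lemma tangent_ball_distance:
  fixes y z :: "'a::real_inner"
  assumes R: "0 < R" "norm (z - y) = R" and \<theta>: "0 < \<theta>" "\<theta> < 1"
    and x: "x \<in> ball (y + \<theta> *\<^sub>R (z - y)) (\<theta> * R)"
  shows "norm (x - z) < R" "(1 - \<theta>) * ((x - y) \<bullet> sgn (z - y)) \<le> R - norm (x - z)"
proof -
  define v e where "v = x - y" and "e = z - y"
  define k where "k = v \<bullet> sgn e"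
  have ve: "v \<bullet> e = R * k"
    using R by (simp add: k_def e_def sgn_div_norm)
  have ee: "e \<bullet> e = R\<^sup>2" using R by (simp add: e_def dot_square_norm)
  have "norm (v - \<theta> *\<^sub>R e) < \<theta> * R"
    using x by (simp add: v_def e_def dist_norm norm_minus_commute algebra_simps)
  then have "(norm (v - \<theta> *\<^sub>R e))\<^sup>2 < (\<theta> * R)\<^sup>2" by (intro power_strict_mono) auto
  then have 1: "v \<bullet> v < 2 * \<theta> * (R * k)"
    unfolding power2_norm_eq_inner
    by (simp add: inner_diff_left inner_diff_right inner_commute[of e v] ve ee
        algebra_simps power2_eq_square)
  have "0 < \<theta> * (R * k)" using 1 inner_ge_zero[of v] by linarith
  then have k: "0 < R * k" using \<theta> by (simp add: zero_less_mult_iff)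
  have "(norm (x - z))\<^sup>2 = v \<bullet> v - 2 * (R * k) + R\<^sup>2"
  proof -
    have "x - z = v - e" by (simp add: v_def e_def)
    then show ?thesis
      by (simp add: power2_norm_eq_inner inner_diff_left inner_diff_right inner_commute[of e v] ve ee)
  qed
  then have 2: "(R - norm (x - z)) * (R + norm (x - z)) \<ge> 2 * (1 - \<theta>) * (R * k)"
    using 1 by (simp add: algebra_simps power2_eq_square)
  have "0 < (1 - \<theta>) * (R * k)" using k \<theta> by simp
  then have "0 < (R - norm (x - z)) * (R + norm (x - z))" using 2 by linarith
  then show lt: "norm (x - z) < R"
    using R norm_ge_zero[of "x - z"] by (simp add: zero_less_mult_iff)
  have "(R - norm (x - z)) * (R + norm (x - z)) \<le> (R - norm (x - z)) * (2 * R)"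
    using lt by (intro mult_left_mono) auto
  then have "R * ((1 - \<theta>) * k) \<le> R * (R - norm (x - z))" using 2 by (simp add: algebra_simps)
  then show "(1 - \<theta>) * ((x - y) \<bullet> sgn (z - y)) \<le> R - norm (x - z)"
    using R by (simp add: k_def v_def e_def)
qed

lemma right_derivative_from_limit:
  fixes f f' :: "real \<Rightarrow> real"
  assumes b: "0 < b" and cont: "continuous_on {0..b} f"
    and der: "\<And>t. 0 < t \<Longrightarrow> t \<le> b \<Longrightarrow> (f has_real_derivative f' t) (at t)"
    and lim: "(f' \<longlongrightarrow> D) (at_right 0)"
  shows "(f has_real_derivative D) (at_right 0)"
  unfolding has_field_derivative_iff
proof (rule tendstoI)
  fix e :: real assume "0 < e"
  then obtain c where c: "0 < c" "\<And>t. 0 < t \<Longrightarrow> t < c \<Longrightarrow> dist (f' t) D < e"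
    using tendstoD[OF lim] unfolding eventually_at_right_field by auto
  show "\<forall>\<^sub>F t in at_right 0. dist ((f t - f 0) / (t - 0)) D < e"
    unfolding eventually_at_right_field
  proof (intro exI[of _ "min b c"] conjI allI impI)
    show "0 < min b c" using b c by simp
    fix t assume t: "0 < t" "t < min b c"
    obtain \<xi> where "0 < \<xi>" "\<xi> < t" "f t - f 0 = f' \<xi> * (t - 0)"
    proof (rule mvt[OF t(1)])
      show "continuous_on {0..t} f" using t by (intro continuous_on_subset[OF cont]) auto
      show "(f has_derivative (*) (f' s)) (at s)" if "0 < s" "s < t" for s
        using der[of s] that t by (simp add: has_field_derivative_def)
    qed
    then show "dist ((f t - f 0) / (t - 0)) D < e" using c(2)[of \<xi>] t by simp
  qed
qed

(* The growth estimate is stated on every smaller ball that is internally tangent to the ball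
   B = ball z R at y.  On B itself it is false in dimension at least 2: for \<Omega> = B = ball 0 1,
   p = 2 and u x = 1 - |x|^2 one has u = 0 on the whole sphere, whereas (x - y) \<bullet> \<nu> is positive
   on the sphere outside y. *)
theorem theorem4p2:
  fixes \<Omega> :: "'a::euclidean_space set" and p u :: "'a \<Rightarrow> real"
    and p1 p2 R :: real and y z \<nu> :: 'a
  assumes "open \<Omega>" and "connected \<Omega>"
    and "1 < p1" and "\<forall>x\<in>\<Omega>. p1 \<le> p x \<and> p x \<le> p2"
    and "\<exists>L. L-lipschitz_on \<Omega> p"
    and "C1_on \<Omega> u" and "\<forall>x\<in>\<Omega>. 0 \<le> u x"
    and "px_laplacian_nonpos \<Omega> p u"
    and "y \<in> frontier \<Omega>"
    and "0 < R" and "ball z R \<subseteq> \<Omega>" and "y \<in> frontier (ball z R)"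
    and "continuous_on (closure (ball z R)) u"
    and "\<forall>x\<in>ball z R. 0 < u x" and "u y = 0"
    and "\<nu> = sgn (z - y)"
  shows "(\<forall>\<theta>. 0 < \<theta> \<and> \<theta> < 1 \<longrightarrow>
            (\<exists>c0>0. \<forall>\<^sub>F x in at y within ball (y + \<theta> *\<^sub>R (z - y)) (\<theta> * R).
               c0 * ((x - y) \<bullet> \<nu>) \<le> u x))
       \<and> (C1_upto \<Omega> y u \<longrightarrow>
            (\<forall>x\<in>\<Omega>. u x = 0) \<or>
            (\<exists>D>0. ((\<lambda>t. u (y + t *\<^sub>R \<nu>)) has_real_derivative D) (at_right 0)))"
proof -
  have yz: "norm (z - y) = R"
    using \<open>y \<in> frontier (ball z R)\<close> \<open>0 < R\<close> by (simp add: dist_norm frontier_ball)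
  obtain L where L: "L-lipschitz_on \<Omega> p" using assms by blast
  have ub: "continuous_on (cball z R) u" using assms by simp
  have pp: "\<forall>x\<in>\<Omega>. p1 \<le> p x" using assms by blast
  obtain c d where c: "0 < c" and d: "0 < d" "d < R"
    and low: "\<And>x. R - d < norm (x - z) \<Longrightarrow> norm (x - z) < R \<Longrightarrow> c * (R - norm (x - z)) \<le> u x"
    using hopf_lower_bound[OF \<open>open \<Omega>\<close> \<open>1 < p1\<close> pp L \<open>C1_on \<Omega> u\<close> \<open>px_laplacian_nonpos \<Omega> p u\<close>
        \<open>0 < R\<close> \<open>ball z R \<subseteq> \<Omega>\<close> ub \<open>\<forall>x\<in>ball z R. 0 < u x\<close>] by blast
  show ?thesis
  proof (intro conjI allI impI)
    fix \<theta> :: real assume \<theta>: "0 < \<theta> \<and> \<theta> < 1"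
    show "\<exists>c0>0. \<forall>\<^sub>F x in at y within ball (y + \<theta> *\<^sub>R (z - y)) (\<theta> * R).
               c0 * ((x - y) \<bullet> \<nu>) \<le> u x"
    proof (intro exI conjI)
      show "0 < c * (1 - \<theta>)" using c \<theta> by simp
      show "\<forall>\<^sub>F x in at y within ball (y + \<theta> *\<^sub>R (z - y)) (\<theta> * R). c * (1 - \<theta>) * ((x - y) \<bullet> \<nu>) \<le> u x"
        unfolding eventually_at
      proof (intro exI[of _ d] conjI ballI impI d(1))
        fix x assume x: "x \<in> ball (y + \<theta> *\<^sub>R (z - y)) (\<theta> * R)" "x \<noteq> y \<and> dist x y < d"
        note tb = tangent_ball_distance[OF \<open>0 < R\<close> yz conjunct1[OF \<theta>] conjunct2[OF \<theta>] x(1)]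
        have "R \<le> norm (x - z) + norm (x - y)"
          using norm_triangle_ineq4[of "x - y" "x - z"] yz by simp
        then have "R - d < norm (x - z)" using x(2) by (simp add: dist_norm)
        note low[OF this tb(1)]
        moreover have "c * ((1 - \<theta>) * ((x - y) \<bullet> \<nu>)) \<le> c * (R - norm (x - z))"
          unfolding \<open>\<nu> = sgn (z - y)\<close> using c by (intro mult_left_mono tb(2)) simp
        ultimately show "c * (1 - \<theta>) * ((x - y) \<bullet> \<nu>) \<le> u x"
          by (simp add: mult.assoc)
      qed
    qed
  next
    assume "C1_upto \<Omega> y u"
    then obtain G where G: "continuous_on (insert y \<Omega>) G" "\<And>x. x \<in> \<Omega> \<Longrightarrow> G x = grad u x"
      and cu: "continuous_on (insert y \<Omega>) u"
      unfolding C1_upto_def by blast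
    have \<nu>: "norm \<nu> = 1" "z - y = R *\<^sub>R \<nu>"
      using yz \<open>0 < R\<close> unfolding \<open>\<nu> = sgn (z - y)\<close> by (auto simp: norm_sgn sgn_div_norm)
    define \<gamma> where "\<gamma> t = y + t *\<^sub>R \<nu>" for t
    have \<gamma>z: "norm (\<gamma> t - z) = R - t" if "t \<le> R" for t
    proof -
      have "\<gamma> t - z = - ((R - t) *\<^sub>R \<nu>)" using \<nu>(2) by (simp add: \<gamma>_def algebra_simps)
      then show ?thesis using that \<nu>(1) by simp
    qed
    have \<gamma>\<Omega>: "\<gamma> t \<in> \<Omega>" if "0 < t" "t \<le> d" for t
      using \<gamma>z[of t] that d \<open>ball z R \<subseteq> \<Omega>\<close> by (auto simp: dist_norm norm_minus_commute subset_iff)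
    have \<gamma>ins: "\<gamma> t \<in> insert y \<Omega>" if "0 \<le> t" "t \<le> d" for t
      using \<gamma>\<Omega>[of t] that by (cases "t = 0") (auto simp: \<gamma>_def)
    then have im: "\<gamma> ` {0..d} \<subseteq> insert y \<Omega>"
      by (intro image_subsetI) (simp only: atLeastAtMost_iff)
    have c\<gamma>: "continuous_on S \<gamma>" for S unfolding \<gamma>_def by (intro continuous_intros)
    have cG: "continuous_on {0..d} (\<lambda>t. G (\<gamma> t) \<bullet> \<nu>)"
      by (intro continuous_on_inner continuous_on_const continuous_on_compose2[OF G(1) c\<gamma>] im)
    have "((\<lambda>t. u (\<gamma> t)) has_real_derivative G (\<gamma> 0) \<bullet> \<nu>) (at_right 0)"
    proof (rule right_derivative_from_limit[OF d(1)])
      show "continuous_on {0..d} (\<lambda>t. u (\<gamma> t))"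
        by (rule continuous_on_compose2[OF cu c\<gamma> im])
      show "((\<lambda>t. u (\<gamma> t)) has_real_derivative G (\<gamma> t) \<bullet> \<nu>) (at t)" if "0 < t" "t \<le> d" for t
      proof -
        have d1: "(\<gamma> has_derivative (\<lambda>h. h *\<^sub>R \<nu>)) (at t)"
          unfolding \<gamma>_def by (auto intro!: derivative_eq_intros)
        have d2: "(u has_derivative (\<lambda>h. h \<bullet> G (\<gamma> t))) (at (\<gamma> t))"
          using C1_onD[OF \<open>C1_on \<Omega> u\<close> \<gamma>\<Omega>[OF that]] G(2)[OF \<gamma>\<Omega>[OF that]] by (simp add: gderiv_def)
        from has_derivative_compose[OF d1 d2] show ?thesis
          unfolding has_field_derivative_def
          by (rule has_derivative_eq_rhs) (auto simp: fun_eq_iff inner_commute)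
      qed
      have "((\<lambda>t. G (\<gamma> t) \<bullet> \<nu>) \<longlongrightarrow> G (\<gamma> 0) \<bullet> \<nu>) (at 0 within {0..d})"
        using cG d(1) by (auto simp: continuous_on_def)
      then show "((\<lambda>t. G (\<gamma> t) \<bullet> \<nu>) \<longlongrightarrow> G (\<gamma> 0) \<bullet> \<nu>) (at_right 0)"
        using d(1) by (simp add: at_within_Icc_at_right)
    qed
    then have der: "((\<lambda>t. u (y + t *\<^sub>R \<nu>)) has_real_derivative G y \<bullet> \<nu>) (at_right 0)"
      by (simp add: \<gamma>_def)
    have "c \<le> G y \<bullet> \<nu>"
    proof (rule tendsto_lowerbound)
      show "((\<lambda>t. (u (y + t *\<^sub>R \<nu>) - u (y + 0 *\<^sub>R \<nu>)) / (t - 0)) \<longlongrightarrow> G y \<bullet> \<nu>) (at_right 0)"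
        using der by (simp only: has_field_derivative_iff)
      show "\<forall>\<^sub>F t in at_right 0. c \<le> (u (y + t *\<^sub>R \<nu>) - u (y + 0 *\<^sub>R \<nu>)) / (t - 0)"
        unfolding eventually_at_right_field
      proof (intro exI[of _ d] conjI allI impI d(1))
        fix t assume t: "0 < t" "t < d"
        have "c * t \<le> u (\<gamma> t)" using low[of "\<gamma> t"] \<gamma>z[of t] t d by simp
        then show "c \<le> (u (y + t *\<^sub>R \<nu>) - u (y + 0 *\<^sub>R \<nu>)) / (t - 0)"
          using t \<open>u y = 0\<close> by (simp add: \<gamma>_def pos_le_divide_eq)
      qed
    qed simp
    \<comment> \<open>The first alternative cannot occur, as \<open>u\<close> is positive in the ball.\<close>
    then have "0 < G y \<bullet> \<nu>" using c by simp
    with der show "(\<forall>x\<in>\<Omega>. u x = 0) \<or>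
        (\<exists>D>0. ((\<lambda>t. u (y + t *\<^sub>R \<nu>)) has_real_derivative D) (at_right 0))"
      by blast
  qed
qed

end
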